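(* Let $G$ be a countable group with a representation of cobounded type on a weakly complete convex proper cone $C\neq\{0\}$ in a Hausdorff locally convex space $E$. If the representation is equicontinuous on $E$, then $G$ fixes a non-zero point in $C$.
   Context: Vector spaces are real. A convex cone $C\subseteq E$ is a subset with $C+C\subseteq C$ and $\mathbf{R}_+C\subseteq C$; it is proper if $C\cap(-C)=\{0\}$. It is weakly complete if it is complete for the uniform structure induced by the weak topology $\sigma(E,E')$. The topological dual $E'$ carries the dual pre-order: $\lambda\geq 0$ iff $\lambda(c)\geq0$ for all $c\in C$. A $G$-representation on a cone $C\subseteq E$ is an action of the (abstract) group $G$ on $E$ by continuous linear maps preserving $C$; $E'$ has the dual representation $(g\varphi)(x)=\varphi(g^{-1}x)$. The representation is of cobounded type if there is $\varphi\in E'$ such that for every $\lambda\in E'$ there are $g_1,\ldots,g_n\in G$ with $\pm\lambda\leq\sum_i g_i\varphi$. The representation is equicontinuous on $E$ if the family of linear maps $E\to E$ given by the elements of $G$ is equicontinuous (for the given topology of $E$). *)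

theory Defs
  imports "HOL-Analysis.Analysis" "HOL-Algebra.Group_Action"
begin

section \<open>Locally convex spaces\<close>

text \<open>Hausdorffness is not part of this class; it is added through the sort \<^class>\<open>t2_space\<close>.\<close>

class locally_convex_space = real_vector + topological_ab_group_add +
  assumes tendsto_scaleR_Pair:
      "LIM x (nhds r \<times>\<^sub>F nhds a). fst x *\<^sub>R snd x :> nhds (r *\<^sub>R a)"
    and locally_convex:
      "open U \<Longrightarrow> 0 \<in> U \<Longrightarrow> \<exists>V. open V \<and> 0 \<in> V \<and> V \<subseteq> U \<and>
        (\<forall>x\<in>V. \<forall>y\<in>V. \<forall>u\<ge>0. \<forall>v\<ge>0. u + v = 1 \<longrightarrow> u *\<^sub>R x + v *\<^sub>R y \<in> V)"

lemma locally_convex_convex: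
  fixes U :: "'a::locally_convex_space set"
  assumes "open U" "0 \<in> U"
  shows "\<exists>V. open V \<and> convex V \<and> 0 \<in> V \<and> V \<subseteq> U"
  using locally_convex[OF assms] unfolding convex_def by blast

instance real_normed_vector \<subseteq> locally_convex_space
proof
  fix r :: real and a :: 'a
  show "LIM x (nhds r \<times>\<^sub>F nhds a). fst x *\<^sub>R snd x :> nhds (r *\<^sub>R a)"
    by (intro tendsto_scaleR filterlim_fst filterlim_snd)
next
  fix U :: "'a set"
  assume "open U" "0 \<in> U"
  then obtain e where "e > 0" "ball 0 e \<subseteq> U"
    by (meson openE)
  moreover have "convex (ball (0::'a) e)"
    by (rule convex_ball)
  ultimately show "\<exists>V. open V \<and> 0 \<in> V \<and> V \<subseteq> U \<and>
      (\<forall>x\<in>V. \<forall>y\<in>V. \<forall>u\<ge>0. \<forall>v\<ge>0. u + v = 1 \<longrightarrow> u *\<^sub>R x + v *\<^sub>R y \<in> V)"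
    unfolding convex_def by (intro exI[of _ "ball 0 e"]) auto
qed

definition continuous_dual :: "('a::locally_convex_space \<Rightarrow> real) set" where
  "continuous_dual = {f. linear f \<and> continuous_on UNIV f}"


section \<open>The weak uniform structure\<close>

text \<open>The initial uniformity, and its topology, for the maps in \<^const>\<open>continuous_dual\<close>.\<close>

definition weak_uniformity :: "('a::locally_convex_space \<times> 'a) filter" where
  "weak_uniformity = (INF f\<in>continuous_dual. filtercomap (map_prod f f) uniformity)"

definition weak_nhds :: "'a::locally_convex_space \<Rightarrow> 'a filter" where
  "weak_nhds x = filtercomap (Pair x) weak_uniformity"

lemma le_weak_nhds_iff:
  "F \<le> weak_nhds x \<longleftrightarrow> (\<forall>f\<in>continuous_dual. (f \<longlongrightarrow> f x) F)"
proof -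
  have "filtercomap (\<lambda>y. (f x, f y)) uniformity = filtercomap f (nhds (f x))"
    for f :: "'a \<Rightarrow> real"
    by (simp add: nhds_eq_comap_uniformity filtercomap_filtercomap)
  then show ?thesis
    by (auto simp: weak_nhds_def weak_uniformity_def filtercomap_INF filtercomap_filtercomap
        le_INF_iff filterlim_def filtermap_le_iff_le_filtercomap)
qed

text \<open>As \<^const>\<open>complete\<close>, whose uniformity is tied to the type.\<close>

definition weakly_complete :: "'a::locally_convex_space set \<Rightarrow> bool" where
  "weakly_complete S \<longleftrightarrow>
    (\<forall>F \<le> principal S. F \<noteq> bot \<longrightarrow> F \<times>\<^sub>F F \<le> weak_uniformity \<longrightarrow> (\<exists>x\<in>S. F \<le> weak_nhds x))"


section \<open>Cones and representations\<close>

definition proper_cone :: "'a::real_vector set \<Rightarrow> bool" where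
  "proper_cone C \<longleftrightarrow> convex_cone C \<and> C \<inter> uminus ` C = {0}"

definition dual_le :: "'a::real_vector set \<Rightarrow> ('a \<Rightarrow> real) \<Rightarrow> ('a \<Rightarrow> real) \<Rightarrow> bool" where
  "dual_le C f h \<longleftrightarrow> (\<forall>c\<in>C. 0 \<le> h c - f c)"

definition cone_representation ::
    "('g, 'm) monoid_scheme \<Rightarrow> ('g \<Rightarrow> 'a \<Rightarrow> 'a) \<Rightarrow> 'a::locally_convex_space set \<Rightarrow> bool" where
  "cone_representation G \<rho> C \<longleftrightarrow>
    group_action G UNIV \<rho> \<and>
    (\<forall>g\<in>carrier G. linear (\<rho> g) \<and> continuous_on UNIV (\<rho> g) \<and> \<rho> g ` C \<subseteq> C)"

definition dual_action ::
    "('g, 'm) monoid_scheme \<Rightarrow> ('g \<Rightarrow> 'a \<Rightarrow> 'a) \<Rightarrow> 'g \<Rightarrow> ('a \<Rightarrow> real) \<Rightarrow> 'a \<Rightarrow> real" where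
  "dual_action G \<rho> g f = (\<lambda>x. f (\<rho> (inv\<^bsub>G\<^esub> g) x))"

definition cobounded_type ::
    "('g, 'm) monoid_scheme \<Rightarrow> ('g \<Rightarrow> 'a \<Rightarrow> 'a) \<Rightarrow> 'a::locally_convex_space set \<Rightarrow> bool" where
  "cobounded_type G \<rho> C \<longleftrightarrow>
    (\<exists>\<phi>\<in>continuous_dual. \<forall>f\<in>continuous_dual. \<exists>(n::nat) g.
      (\<forall>i\<in>{1..n}. g i \<in> carrier G) \<and>
      dual_le C f (\<lambda>x. \<Sum>i=1..n. dual_action G \<rho> (g i) \<phi> x) \<and>
      dual_le C (\<lambda>x. - f x) (\<lambda>x. \<Sum>i=1..n. dual_action G \<rho> (g i) \<phi> x))"

text \<open>Equicontinuity at every point, with respect to the translation-invariant uniformity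
  of the topological vector space.\<close>

definition equicontinuous_rep ::
    "('g, 'm) monoid_scheme \<Rightarrow> ('g \<Rightarrow> 'a \<Rightarrow> 'a::locally_convex_space) \<Rightarrow> bool" where
  "equicontinuous_rep G \<rho> \<longleftrightarrow>
    (\<forall>x W. open W \<longrightarrow> 0 \<in> W \<longrightarrow>
      eventually (\<lambda>y. \<forall>g\<in>carrier G. \<rho> g y - \<rho> g x \<in> W) (nhds x))"

end

theory Submission
  imports Defs
begin

text \<open>
  Equicontinuity makes weighted sums over the whole group available: if \<open>\<phi>\<close> is continuous, then so is
  \<open>\<Sum>n. 2\<^sup>-\<^sup>n\<^sup>-\<^sup>1 \<phi> \<circ> \<rho> (enum n)\<close>, where \<open>enum\<close> enumerates the countable group. Applied to the
  functional of the cobounded type, this produces a single continuous functional \<open>\<psi>\<close> that is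
  non-negative on the cone and dominates every continuous functional up to a factor
  (\<open>cobounded_imp_order_unit\<close>). The cone then has a weakly compact base, and since weakly
  absolutely convergent series converge in a weakly complete cone, a summation argument shows that
  \<open>\<psi> \<circ> \<rho> g \<le> K \<psi>\<close> on the cone with one constant for all \<open>g\<close>
  (\<open>order_unit_uniformly_dominated\<close>). Hence \<open>\<psi>\<close> stays away from \<open>0\<close> on every orbit of a non-zero
  point \<open>b\<close>, and the closed convex hull of that orbit is a weakly compact invariant convex set that
  misses the origin.

  What is left is a fixed point theorem of Ryll-Nardzewski type for this hull. The averaging operator
  \<open>T = \<Sum>n. 2\<^sup>-\<^sup>n\<^sup>-\<^sup>1 \<rho> (enum n)\<close> has a fixed point \<open>x\<close> in the hull, as a weak cluster point of Cesaro
  means (\<open>stationary_point\<close>). Following Namioka and Asplund, \<open>x\<close> is fixed by the whole group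
  (\<open>stationary_imp_fixed\<close>). Suppose \<open>\<rho> g x \<noteq> x\<close>. A functional separating the two points has an
  equicontinuous orbit, and the supremum of the absolute values over this orbit is an invariant
  seminorm, so \<open>\<rho> s x\<close> and \<open>\<rho> s (\<rho> g x)\<close> keep a fixed distance for all \<open>s\<close>. But the hull of the orbit
  of \<open>x\<close> has slices \<open>{y. f y > m - \<eta>}\<close>, with \<open>m\<close> the supremum of \<open>f\<close>, of arbitrarily small diameter
  (\<open>small_slices\<close>). Some \<open>\<rho> s x\<close> lies very close to the top of such a slice, and being a countable
  convex combination of the points \<open>\<rho> s (\<rho> (enum n) x)\<close> it forces \<open>\<rho> s (\<rho> g x)\<close> into the slice as well,
  a contradiction.

  The existence of small slices rests on separability of the hull for the invariant seminorm, which
  comes from the Hahn-Banach theorem, and on the Baire property of a minimal closed set with the same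
  support function as the hull. This set replaces the closure of the extreme points, and working
  with support functions throughout replaces the Krein-Milman theorem and its converse.
\<close>

section \<open>The Hahn-Banach theorem\<close>

definition sublinear :: "('a::real_vector \<Rightarrow> real) \<Rightarrow> bool" where
  "sublinear q \<longleftrightarrow> (\<forall>x y. q (x + y) \<le> q x + q y) \<and> (\<forall>t x. 0 < t \<longrightarrow> q (t *\<^sub>R x) = t * q x)"

lemma sublinear_zero:
  assumes "sublinear q" shows "q 0 = 0"
proof -
  have "q (2 *\<^sub>R 0) = 2 * q 0"
    using assms unfolding sublinear_def by (metis zero_less_numeral)
  then show ?thesis by simp
qed

lemma sublinear_add: "sublinear q \<Longrightarrow> q (x + y) \<le> q x + q y"
  by (simp add: sublinear_def)

lemma sublinear_scale:
  assumes "sublinear q" "0 \<le> t" shows "q (t *\<^sub>R x) = t * q x"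
  using assms sublinear_zero[of q] by (cases "t = 0") (auto simp: sublinear_def)

lemma sublinear_ge:
  assumes "sublinear q" shows "- q (- x) \<le> q x"
  using sublinear_add[OF assms, of x "- x"] sublinear_zero[OF assms] by simp

text \<open>The largest sublinear functional below \<open>q\<close> whose value at \<open>- x\<close> is at most \<open>- q x\<close>, that is,
  \<open>q\<close> modified so that it becomes additive in the direction of \<open>x\<close>.\<close>

definition push_down :: "('a::real_vector \<Rightarrow> real) \<Rightarrow> 'a \<Rightarrow> 'a \<Rightarrow> real" where
  "push_down q x y = (INF t\<in>{0..}. q (y + t *\<^sub>R x) - t * q x)"

lemma push_down_bdd:
  assumes "sublinear q"
  shows "bdd_below ((\<lambda>t. q (y + t *\<^sub>R x) - t * q x) ` {0..})"
proof (rule bdd_belowI2[where m = "- q (- y)"])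
  fix t :: real assume "t \<in> {0..}"
  then have "t * q x \<le> q (y + t *\<^sub>R x) + q (- y)"
    using sublinear_add[OF assms, of "y + t *\<^sub>R x" "- y"] sublinear_scale[OF assms, of t x] by simp
  then show "- q (- y) \<le> q (y + t *\<^sub>R x) - t * q x" by simp
qed

lemma push_down_le:
  assumes "sublinear q" "0 \<le> t" shows "push_down q x y \<le> q (y + t *\<^sub>R x) - t * q x"
  unfolding push_down_def using push_down_bdd[OF assms(1)] assms(2) by (intro cINF_lower) auto

lemma sublinear_push_down:
  assumes q: "sublinear q" shows "sublinear (push_down q x)"
  unfolding sublinear_def
proof (intro conjI allI impI)
  fix y z
  have "push_down q x (y + z) - (q (z + t *\<^sub>R x) - t * q x) \<le> push_down q x y" if "0 \<le> t" for t
    unfolding push_down_def[of q x y]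
  proof (rule cINF_greatest)
    fix s :: real assume s: "s \<in> {0..}"
    have "push_down q x (y + z) \<le> q (y + z + (s + t) *\<^sub>R x) - (s + t) * q x"
      using push_down_le[OF q] s that by simp
    also have "q (y + z + (s + t) *\<^sub>R x) \<le> q (y + s *\<^sub>R x) + q (z + t *\<^sub>R x)"
      using sublinear_add[OF q, of "y + s *\<^sub>R x" "z + t *\<^sub>R x"] by (simp add: algebra_simps)
    finally show "push_down q x (y + z) - (q (z + t *\<^sub>R x) - t * q x) \<le> q (y + s *\<^sub>R x) - s * q x"
      by (simp add: algebra_simps)
  qed simp
  then have "push_down q x (y + z) - push_down q x y \<le> push_down q x z"
    unfolding push_down_def[of q x z] by (intro cINF_greatest) (auto simp: algebra_simps)
  then show "push_down q x (y + z) \<le> push_down q x y + push_down q x z" by simp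
next
  fix t :: real and y assume t: "0 < t"
  have le: "push_down q x (t *\<^sub>R y) \<le> t * push_down q x y" if t: "0 < t" for t y
  proof -
    have "push_down q x (t *\<^sub>R y) / t \<le> push_down q x y"
      unfolding push_down_def[of q x y]
    proof (rule cINF_greatest)
      fix s :: real assume s: "s \<in> {0..}"
      have "push_down q x (t *\<^sub>R y) \<le> q (t *\<^sub>R y + (t * s) *\<^sub>R x) - (t * s) * q x"
        using push_down_le[OF q] s t by simp
      also have "q (t *\<^sub>R y + (t * s) *\<^sub>R x) = t * q (y + s *\<^sub>R x)"
        using sublinear_scale[OF q, of t "y + s *\<^sub>R x"] t by (simp add: scaleR_add_right)
      finally show "push_down q x (t *\<^sub>R y) / t \<le> q (y + s *\<^sub>R x) - s * q x"
        using t by (simp add: field_simps)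
    qed simp
    then show ?thesis using t by (simp add: field_simps)
  qed
  have "push_down q x y \<le> push_down q x (t *\<^sub>R y) / t"
    using le[of "1 / t" "t *\<^sub>R y"] t by simp
  with le[OF t] t show "push_down q x (t *\<^sub>R y) = t * push_down q x y"
    by (simp add: field_simps antisym)
qed

text \<open>Zorn's lemma applies because a sublinear \<open>p \<le> q\<close> satisfies \<open>p x \<ge> - q (- x)\<close>, so that
  pointwise infima of chains are finite.\<close>

lemma minimal_sublinear_below:
  fixes q :: "'a::real_vector \<Rightarrow> real"
  assumes q: "sublinear q"
  shows "\<exists>p. sublinear p \<and> p \<le> q \<and> (\<forall>p'. sublinear p' \<longrightarrow> p' \<le> p \<longrightarrow> p' = p)"
proof -
  define A where "A = {p. sublinear p \<and> p \<le> q}"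
  have "\<exists>m\<in>A. \<forall>a\<in>A. m \<ge> a \<longrightarrow> a = m"
  proof (rule predicate_Zorn)
    show "partial_order_on A (relation_of (\<ge>) A)"
      by (rule partial_order_on_relation_ofI) auto
  next
    fix P assume "P \<in> Chains (relation_of (\<ge>) A)"
    then have PA: "P \<subseteq> A" and ch: "\<And>a b. a \<in> P \<Longrightarrow> b \<in> P \<Longrightarrow> a \<le> b \<or> b \<le> a"
      unfolding Chains_def relation_of_def by auto
    show "\<exists>u\<in>A. \<forall>a\<in>P. u \<le> a"
    proof (cases "P = {}")
      case True
      then show ?thesis using q by (auto simp: A_def)
    next
      case False
      have bdd: "bdd_below ((\<lambda>p. p x) ` P)" for x
      proof (rule bdd_belowI2[where m = "- q (- x)"])
        fix p assume "p \<in> P"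
        then have "sublinear p" "p (- x) \<le> q (- x)" using PA by (auto simp: A_def le_fun_def)
        then show "- q (- x) \<le> p x" using sublinear_ge[of p x] by linarith
      qed
      define u where "u x = (INF p\<in>P. p x)" for x
      have u_le: "u x \<le> p x" if "p \<in> P" for p x
        unfolding u_def using bdd that by (rule cINF_lower)
      have "sublinear u"
        unfolding sublinear_def
      proof (intro conjI allI impI)
        fix x y
        have sub: "u (x + y) \<le> p x + p' y" if pp: "p \<in> P" "p' \<in> P" for p p'
        proof -
          obtain r where r: "r \<in> P" "r \<le> p" "r \<le> p'"
            using ch[OF pp] pp by blast
          have "sublinear r" using r(1) PA by (auto simp: A_def)
          then have "u (x + y) \<le> r x + r y"
            using u_le[OF r(1), of "x + y"] sublinear_add[of r x y] by linarith
          also have "\<dots> \<le> p x + p' y" using r by (simp add: le_fun_def add_mono)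
          finally show ?thesis .
        qed
        have sub': "u (x + y) - p x \<le> u y" if "p \<in> P" for p
          unfolding u_def[of y]
        proof (rule cINF_greatest[OF False])
          show "u (x + y) - p x \<le> p' y" if "p' \<in> P" for p'
            using sub[OF \<open>p \<in> P\<close> that] by simp
        qed
        have "u (x + y) - u y \<le> u x"
          unfolding u_def[of x]
        proof (rule cINF_greatest[OF False])
          show "u (x + y) - u y \<le> p x" if "p \<in> P" for p
            using sub'[OF that] by simp
        qed
        then show "u (x + y) \<le> u x + u y" by simp
      next
        fix t :: real and x assume t: "0 < t"
        have le: "u (t *\<^sub>R x) \<le> t * u x" if t: "0 < t" for t x
        proof -
          have "u (t *\<^sub>R x) / t \<le> u x"
            unfolding u_def[of x]
          proof (rule cINF_greatest[OF False])
            fix p assume p: "p \<in> P"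
            have "sublinear p" using p PA by (auto simp: A_def)
            then have "u (t *\<^sub>R x) \<le> t * p x"
              using u_le[OF p, of "t *\<^sub>R x"] sublinear_scale[of p t x] t by simp
            then show "u (t *\<^sub>R x) / t \<le> p x" using t by (simp add: field_simps)
          qed
          then show ?thesis using t by (simp add: field_simps)
        qed
        have "u x \<le> u (t *\<^sub>R x) / t" using le[of "1 / t" "t *\<^sub>R x"] t by simp
        with le[OF t, of x] t show "u (t *\<^sub>R x) = t * u x" by (simp add: field_simps antisym)
      qed
      moreover have "u \<le> q"
      proof -
        obtain p where p: "p \<in> P" using False by blast
        then have "u \<le> p" using u_le by (simp add: le_fun_def)
        also have "p \<le> q" using p PA by (auto simp: A_def)
        finally show ?thesis .
      qed
      ultimately have "u \<in> A" by (simp add: A_def)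
      moreover have "\<forall>a\<in>P. u \<le> a" using u_le by (simp add: le_fun_def)
      ultimately show ?thesis by blast
    qed
  qed
  then obtain p where "p \<in> A" and min: "\<And>a. a \<in> A \<Longrightarrow> a \<le> p \<Longrightarrow> a = p" by blast
  have "p' = p" if "sublinear p'" "p' \<le> p" for p'
    using min[of p'] that \<open>p \<in> A\<close> by (auto simp: A_def intro: order_trans)
  then show ?thesis using \<open>p \<in> A\<close> by (auto simp: A_def)
qed

text \<open>A minimal sublinear functional is linear, since pushing it down in any direction cannot change it.
  Starting below \<open>push_down q x\<close> instead of \<open>q\<close> pins the value at \<open>x\<close>.\<close>

theorem hahn_banach_sublinear:
  fixes q :: "'a::real_vector \<Rightarrow> real"
  assumes q: "sublinear q"
  shows "\<exists>f. linear f \<and> (\<forall>y. f y \<le> q y) \<and> f x = q x"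
proof -
  obtain p where p: "sublinear p" and le: "p \<le> push_down q x"
    and min: "\<And>p'. sublinear p' \<Longrightarrow> p' \<le> p \<Longrightarrow> p' = p"
    using minimal_sublinear_below[OF sublinear_push_down[OF q]] by blast
  have push_self: "push_down r z y \<le> r y" if "sublinear r" for r :: "'a \<Rightarrow> real" and z y
    using push_down_le[OF that, of 0 z y] by simp
  have eq: "push_down p z = p" for z
    using min[OF sublinear_push_down[OF p]] push_self[OF p] by (auto simp: le_fun_def)
  have add: "p (y + z) = p y + p z" for y z
    using push_down_le[OF p, of 1 z y] eq[of z] sublinear_add[OF p, of y z] by simp
  have neg: "p (- y) = - p y" for y
    using add[of y "- y"] sublinear_zero[OF p] by simp
  have scale: "p (t *\<^sub>R y) = t * p y" for t y
  proof (cases "0 \<le> t")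
    case False
    then have "p ((- t) *\<^sub>R y) = - t * p y" by (intro sublinear_scale[OF p]) simp
    then show ?thesis using neg[of "t *\<^sub>R y"] by simp
  qed (simp add: sublinear_scale[OF p])
  have "linear p" by (rule linearI) (simp_all add: add scale)
  moreover have "p y \<le> q y" for y
    using le push_self[OF q, of x y] by (auto simp: le_fun_def intro: order_trans)
  moreover have "q x \<le> p x"
    using le push_down_le[OF q, of 1 x "- x"] neg[of x] sublinear_zero[OF q]
    by (simp add: le_fun_def) (metis add.commute add.left_neutral neg_le_iff_le order_trans)
  ultimately show ?thesis by (metis antisym)
qed

section \<open>Weak completeness and weak compactness\<close>

lemma tendsto_scaleR_lcs:
  fixes g :: "'b \<Rightarrow> 'a::locally_convex_space"
  assumes "(f \<longlongrightarrow> r) F" "(g \<longlongrightarrow> a) F"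
  shows "((\<lambda>x. f x *\<^sub>R g x) \<longlongrightarrow> r *\<^sub>R a) F"
  using filterlim_compose[OF tendsto_scaleR_Pair, of "\<lambda>x. (f x, g x)" r a F] assms
  by (simp add: nhds_prod[symmetric] tendsto_Pair)

lemma tendsto_diff_nhds: "((\<lambda>y. y - x) \<longlongrightarrow> 0) (nhds (x::'a::locally_convex_space))"
  using tendsto_diff[OF filterlim_ident tendsto_const, of x x] by simp

lemma continuous_dualI:
  fixes f :: "'a::locally_convex_space \<Rightarrow> real"
  assumes f: "linear f" and bdd: "eventually (\<lambda>y. \<bar>f y\<bar> \<le> 1) (nhds 0)"
  shows "f \<in> continuous_dual"
proof -
  have "(f \<longlongrightarrow> f x) (nhds x)" for x
  proof (rule tendstoI)
    fix e :: real assume e: "0 < e"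
    have "((\<lambda>y. (2 / e) *\<^sub>R (y - x)) \<longlongrightarrow> 0) (nhds x)"
      using tendsto_scaleR_lcs[OF tendsto_const tendsto_diff_nhds, of "2 / e" x] by simp
    then have "eventually (\<lambda>y. \<bar>f ((2 / e) *\<^sub>R (y - x))\<bar> \<le> 1) (nhds x)"
      using bdd by (rule eventually_compose_filterlim[rotated])
    then show "eventually (\<lambda>y. dist (f y) (f x) < e) (nhds x)"
    proof (rule eventually_mono)
      fix y assume "\<bar>f ((2 / e) *\<^sub>R (y - x))\<bar> \<le> 1"
      then have "\<bar>(2 / e) * (f y - f x)\<bar> \<le> 1"
        by (simp only: linear_scale[OF f] linear_diff[OF f] real_scaleR_def)
      then have "(2 / e) * \<bar>f y - f x\<bar> \<le> 1"
        using e by (simp only: abs_mult) simp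
      then have "\<bar>f y - f x\<bar> \<le> e / 2" using e by (simp add: pos_le_divide_eq mult.commute)
      then show "dist (f y) (f x) < e" using e by (simp add: dist_real_def)
    qed
  qed
  then show ?thesis
    using f by (simp add: continuous_dual_def continuous_on_def tendsto_at_iff_tendsto_nhds)
qed

lemma continuous_dual_linear: "f \<in> continuous_dual \<Longrightarrow> linear f"
  by (simp add: continuous_dual_def)

text \<open>This is the sublinear version for the Minkowski functional \<open>q\<close> of \<open>V\<close>: it is at least \<open>1\<close> at
  \<open>x\<close>, and a linear functional below it is bounded on \<open>V \<inter> - V\<close>, hence continuous.\<close>

theorem hahn_banach_open_convex:
  fixes V :: "'a::locally_convex_space set"
  assumes V: "open V" "convex V" "0 \<in> V" and x: "x \<notin> V"
  shows "\<exists>f\<in>continuous_dual. (\<forall>v\<in>V. f v \<le> 1) \<and> 1 \<le> f x"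
proof -
  define T where "T y = {t::real. 0 < t \<and> (1 / t) *\<^sub>R y \<in> V}" for y
  define q where "q y = Inf (T y)" for y
  have shrink: "s *\<^sub>R v \<in> V" if "v \<in> V" "0 \<le> s" "s \<le> 1" for s :: real and v
    using convexD[OF V(2) that(1) V(3), of s "1 - s"] that by simp
  have T_ne: "T y \<noteq> {}" for y
  proof -
    have "((\<lambda>n. (1 / real (Suc n)) *\<^sub>R y) \<longlongrightarrow> 0) sequentially"
      using tendsto_scaleR_lcs[OF LIMSEQ_inverse_real_of_nat tendsto_const, of y]
      by (simp add: divide_inverse)
    then have "eventually (\<lambda>n. (1 / real (Suc n)) *\<^sub>R y \<in> V) sequentially"
      using V by (auto simp: tendsto_def)
    then obtain n where "(1 / real (Suc n)) *\<^sub>R y \<in> V"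
      unfolding eventually_sequentially by blast
    then have "real (Suc n) \<in> T y" by (simp add: T_def)
    then show ?thesis by blast
  qed
  have T_bdd: "bdd_below (T y)" for y by (rule bdd_belowI[of _ 0]) (simp add: T_def)
  have q_le: "q y \<le> t" if "0 < t" "(1 / t) *\<^sub>R y \<in> V" for t y
    unfolding q_def using that by (intro cInf_lower[OF _ T_bdd]) (simp add: T_def)
  have q_less: "(1 / t) *\<^sub>R y \<in> V" if lt: "q y < t" for t y
  proof -
    obtain s where s: "0 < s" "(1 / s) *\<^sub>R y \<in> V" "s < t"
      using cInf_lessD[OF T_ne lt[unfolded q_def]] by (auto simp: T_def)
    have "(s / t) *\<^sub>R ((1 / s) *\<^sub>R y) \<in> V" using s by (intro shrink[OF s(2)]) auto
    then show ?thesis using s by simp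
  qed
  have q_nonneg: "0 \<le> q y" for y
    unfolding q_def by (rule cInf_greatest[OF T_ne]) (simp add: T_def)
  have "sublinear q"
    unfolding sublinear_def
  proof (intro conjI allI impI)
    fix y z
    show "q (y + z) \<le> q y + q z"
    proof (rule field_le_epsilon)
      fix e :: real assume e: "0 < e"
      define s where "s = q y + e / 2"
      define t where "t = q z + e / 2"
      have st: "0 < s" "0 < t" using q_nonneg[of y] q_nonneg[of z] e by (auto simp: s_def t_def)
      have "(1 / s) *\<^sub>R y \<in> V" "(1 / t) *\<^sub>R z \<in> V"
        using q_less[of y s] q_less[of z t] e by (auto simp: s_def t_def)
      moreover have "s / (s + t) + t / (s + t) = 1"
        using st by (simp add: add_divide_distrib[symmetric])
      ultimately have "(s / (s + t)) *\<^sub>R ((1 / s) *\<^sub>R y) + (t / (s + t)) *\<^sub>R ((1 / t) *\<^sub>R z) \<in> V"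
        using st by (intro convexD[OF V(2)]) simp_all
      then have "(1 / (s + t)) *\<^sub>R (y + z) \<in> V" using st by (simp add: scaleR_add_right)
      then have "q (y + z) \<le> s + t" using st by (intro q_le) auto
      then show "q (y + z) \<le> q y + q z + e" by (simp add: s_def t_def)
    qed
  next
    fix t :: real and y assume t: "0 < t"
    have le: "q (t *\<^sub>R y) \<le> t * q y" if t: "0 < t" for t y
    proof (rule field_le_epsilon)
      fix e :: real assume e: "0 < e"
      define r where "r = q y + e / t"
      have r: "0 < r" "q y < r" using q_nonneg[of y] e t by (auto simp: r_def add_nonneg_pos)
      have "(1 / (t * r)) *\<^sub>R (t *\<^sub>R y) \<in> V" using q_less[OF r(2)] t by simp
      then have "q (t *\<^sub>R y) \<le> t * r" using r t by (intro q_le) auto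
      then show "q (t *\<^sub>R y) \<le> t * q y + e" using t by (simp add: r_def distrib_left)
    qed
    have "q y \<le> q (t *\<^sub>R y) / t" using le[of "1 / t" "t *\<^sub>R y"] t by simp
    with le[OF t, of y] t show "q (t *\<^sub>R y) = t * q y" by (simp add: field_simps antisym)
  qed
  from hahn_banach_sublinear[OF this, of x] obtain f
    where f: "linear f" "\<And>y. f y \<le> q y" "f x = q x" by blast
  have f_le: "f v \<le> 1" if "v \<in> V" for v
    using q_le[of 1 v] that f(2)[of v] by simp
  have "1 \<le> f x" using q_less[of x 1] x f(3) by (cases "q x < 1") auto
  moreover have "f \<in> continuous_dual"
  proof (rule continuous_dualI[OF f(1)])
    have "((\<lambda>y. y) \<longlongrightarrow> 0) (nhds (0::'a))" "((\<lambda>y. - y) \<longlongrightarrow> 0) (nhds (0::'a))"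
      using tendsto_minus[OF filterlim_ident, of "0::'a"] by (auto simp: filterlim_ident)
    then have "eventually (\<lambda>y. y \<in> V) (nhds 0)" "eventually (\<lambda>y. - y \<in> V) (nhds 0)"
      using V unfolding tendsto_def by blast+
    then show "eventually (\<lambda>y. \<bar>f y\<bar> \<le> 1) (nhds 0)"
    proof eventually_elim
      case (elim y)
      then show ?case using f_le[of y] f_le[of "- y"] linear_neg[OF f(1), of y] by simp
    qed
  qed
  ultimately show ?thesis using f_le by blast
qed

corollary continuous_dual_separates:
  fixes x :: "'a::{locally_convex_space, t2_space}"
  assumes "x \<noteq> 0" shows "\<exists>f\<in>continuous_dual. f x \<noteq> 0"
proof -
  obtain U where "open U" "0 \<in> U" "x \<notin> U"
    using t1_space[of 0 x] assms by auto
  then obtain V where "open V" "convex V" "0 \<in> V" "x \<notin> V"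
    using locally_convex_convex[of U] by blast
  from hahn_banach_open_convex[OF this] obtain f where "f \<in> continuous_dual" "1 \<le> f x" by blast
  then show ?thesis by (intro bexI[of _ f]) auto
qed

text \<open>Pointwise convergence on the dual suffices: it makes a filter Cauchy for the weak uniformity.\<close>

lemma weakly_complete_limit:
  assumes C: "weakly_complete C" and F: "F \<le> principal C" "F \<noteq> bot"
    and lim: "\<And>f. f \<in> continuous_dual \<Longrightarrow> \<exists>l. (f \<longlongrightarrow> l) F"
  shows "\<exists>x\<in>C. \<forall>f\<in>continuous_dual. (f \<longlongrightarrow> f x) F"
proof -
  have "F \<times>\<^sub>F F \<le> filtercomap (map_prod f f) uniformity" if f: "f \<in> continuous_dual" for f
  proof -
    obtain l where "filtermap f F \<le> nhds l" using lim[OF f] by (auto simp: filterlim_def)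
    then have "filtermap f F \<times>\<^sub>F filtermap f F \<le> uniformity"
      using nhds_imp_cauchy_filter cauchy_filter_def by blast
    moreover have "(\<lambda>x. apsnd f (apfst f x)) = map_prod f f" by (auto simp: fun_eq_iff)
    ultimately show ?thesis
      by (simp only: prod_filtermap1 prod_filtermap2 filtermap_filtermap
          filtermap_le_iff_le_filtercomap)
  qed
  then have "F \<times>\<^sub>F F \<le> weak_uniformity" by (auto simp: weak_uniformity_def le_INF_iff)
  then show ?thesis using C F by (auto simp: weakly_complete_def le_weak_nhds_iff)
qed

text \<open>The weak topology is handled as the topology of pointwise convergence on functionals. The
  value \<open>0\<close> outside the dual makes the image of a weakly compact set compact in the full product.\<close>

definition evaluation :: "'a::locally_convex_space \<Rightarrow> ('a \<Rightarrow> real) \<Rightarrow> real" where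
  "evaluation x = (\<lambda>f. if f \<in> continuous_dual then f x else 0)"

lemma continuous_coordinate: "continuous_on A (\<lambda>y. y i :: 'b::topological_space)"
  by (rule continuous_on_subset[OF continuous_on_product_coordinates subset_UNIV])

lemma compact_Pi_intervals: "compact {y. \<forall>i. y i \<in> {a i..b i::real}}"
proof -
  have "compactin (product_topology (\<lambda>_. euclidean) UNIV) (PiE UNIV (\<lambda>i. {a i..b i}))"
    by (rule compactin_PiE[THEN iffD2]) simp
  moreover have "PiE UNIV (\<lambda>i. {a i..b i}) = {y. \<forall>i. y i \<in> {a i..b i}}"
    by (simp only: PiE_UNIV_domain Pi_def) blast
  ultimately show ?thesis by (simp only: euclidean_product_topology compactin_euclidean_iff)
qed

text \<open>The bound \<open>u\<close> at \<open>f\<close> and at \<open>- f\<close> confines the set to a product of compact intervals, and weak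
  completeness makes it closed there.\<close>

lemma weakly_compact_section:
  fixes C :: "'a::locally_convex_space set" and u :: "('a \<Rightarrow> real) \<Rightarrow> real"
  assumes C: "weakly_complete C"
  defines "S \<equiv> {x\<in>C. \<forall>f\<in>continuous_dual. f x \<le> u f}"
  shows "compact (evaluation ` S)"
proof -
  define a where "a f = (if f \<in> continuous_dual then - u (\<lambda>x. - f x) else 0)" for f
  define b where "b f = (if f \<in> continuous_dual then u f else 0)" for f
  have neg: "(\<lambda>x. - f x) \<in> continuous_dual" if "f \<in> continuous_dual" for f :: "'a \<Rightarrow> real"
    using that by (auto simp: continuous_dual_def linear_compose_neg intro: continuous_on_minus)
  have "evaluation ` S \<subseteq> {y. \<forall>f. y f \<in> {a f..b f}}"
  proof clarify
    fix x f assume "x \<in> S"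
    then show "evaluation x f \<in> {a f..b f}"
      using neg[of f] by (force simp: S_def evaluation_def a_def b_def)
  qed
  then have eq: "evaluation ` S = {y. \<forall>f. y f \<in> {a f..b f}} \<inter> evaluation ` S" by (rule inf.absorb2[symmetric])
  have cl: "closed (evaluation ` S)"
    unfolding closed_def open_subopen[of "- _"]
  proof (intro ballI, rule ccontr)
    fix y assume y: "y \<in> - evaluation ` S"
      and no: "\<nexists>T. open T \<and> y \<in> T \<and> T \<subseteq> - evaluation ` S"
    define F where "F = inf (filtercomap evaluation (nhds y)) (principal S)"
    have "F \<noteq> bot"
    proof
      assume "F = bot"
      then have "eventually (\<lambda>x. False) F" by simp
      then obtain T where T: "open T" "y \<in> T" "\<And>x. evaluation x \<in> T \<Longrightarrow> x \<notin> S"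
        unfolding F_def eventually_inf_principal eventually_filtercomap eventually_nhds by blast
      then have "T \<subseteq> - evaluation ` S" by auto
      then show False using no T by blast
    qed
    have "filterlim evaluation (nhds y) F"
      unfolding F_def filterlim_def filtermap_le_iff_le_filtercomap by simp
    moreover have "((\<lambda>z. z f) \<longlongrightarrow> y f) (nhds y)" for f
    proof -
      have "((\<lambda>z. z f) \<longlongrightarrow> y f) (at y)"
        using continuous_on_product_coordinates[of f, where 'b=real] by (simp add: continuous_on_def)
      then show ?thesis
        using tendsto_at_iff_tendsto_nhds[of "\<lambda>z. z f" y] by simp
    qed
    ultimately have lim0: "((\<lambda>x. evaluation x f) \<longlongrightarrow> y f) F" for f
      using filterlim_compose by blast
    have lim: "(f \<longlongrightarrow> y f) F" if "f \<in> continuous_dual" for f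
      using lim0[of f] that by (simp add: evaluation_def)
    have "F \<le> principal C" by (auto simp: F_def S_def intro!: le_infI2)
    then obtain x where x: "x \<in> C" "\<And>f. f \<in> continuous_dual \<Longrightarrow> (f \<longlongrightarrow> f x) F"
      using weakly_complete_limit[OF C _ \<open>F \<noteq> bot\<close>] lim by blast
    have eq: "f x = y f" if "f \<in> continuous_dual" for f
      using tendsto_unique[OF \<open>F \<noteq> bot\<close>] x(2)[OF that] lim[OF that] by blast
    have "y f = 0" if "f \<notin> continuous_dual" for f
      using lim0[of f] that tendsto_unique[OF \<open>F \<noteq> bot\<close> _ tendsto_const]
      by (simp add: evaluation_def)
    with eq have "y = evaluation x" by (auto simp: evaluation_def)
    moreover have "f x \<le> u f" if "f \<in> continuous_dual" for f
    proof (rule tendsto_upperbound[OF x(2)[OF that] _ \<open>F \<noteq> bot\<close>])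
      show "eventually (\<lambda>x. f x \<le> u f) F"
        using that by (auto simp: F_def S_def eventually_inf_principal)
    qed
    ultimately show False using y x(1) by (auto simp: S_def)
  qed
  show ?thesis
    by (subst eq) (rule compact_Int_closed[OF compact_Pi_intervals cl])
qed

lemma weakly_convergent_series:
  assumes C: "weakly_complete C" "convex_cone C" and x: "\<And>n. x n \<in> C"
    and sm: "\<And>f. f \<in> continuous_dual \<Longrightarrow> summable (\<lambda>n. f (x n))"
  shows "\<exists>y\<in>C. \<forall>f\<in>continuous_dual. (\<lambda>n. f (x n)) sums f y"
proof -
  define X where "X N = (\<Sum>n<N. x n)" for N
  have XC: "X N \<in> C" for N
    using C(2) x by (induction N) (auto simp: X_def convex_cone_contains_0 convex_cone_add)
  have fX: "f (X N) = (\<Sum>n<N. f (x n))" if "f \<in> continuous_dual" for f N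
    using continuous_dual_linear[OF that] by (simp add: X_def linear_sum)
  have "\<exists>y\<in>C. \<forall>f\<in>continuous_dual. (f \<longlongrightarrow> f y) (filtermap X sequentially)"
  proof (rule weakly_complete_limit[OF C(1)])
    show "filtermap X sequentially \<le> principal C"
      by (simp add: le_principal eventually_filtermap XC)
    show "filtermap X sequentially \<noteq> bot" by (simp add: filtermap_bot_iff)
    show "\<exists>l. (f \<longlongrightarrow> l) (filtermap X sequentially)" if "f \<in> continuous_dual" for f
      using sm[OF that] fX[OF that]
      by (auto simp: filterlim_def filtermap_filtermap summable_def sums_def)
  qed
  then show ?thesis
    using fX by (auto simp: filterlim_def filtermap_filtermap sums_def)
qed

section \<open>Equicontinuous families of functionals\<close>

lemma continuous_dual_lincomb:
  assumes "f \<in> continuous_dual" "g \<in> continuous_dual"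
  shows "(\<lambda>x. s * f x + t * g x) \<in> continuous_dual"
  using assms unfolding continuous_dual_def
  by (auto intro!: linearI continuous_intros simp: linear_add linear_scale algebra_simps)

lemma continuous_dual_zero: "(\<lambda>x. 0) \<in> continuous_dual"
  by (auto simp: continuous_dual_def intro: linearI)

lemma continuous_dual_arith:
  assumes "f \<in> continuous_dual"
  shows "f 0 = 0" "f (x + y) = f x + f y" "f (x - y) = f x - f y" "f (r *\<^sub>R x) = r * f x"
  using continuous_dual_linear[OF assms]
  by (simp_all only: linear_0 linear_add linear_diff linear_scale real_scaleR_def)

definition equicontinuous :: "('a::topological_space \<Rightarrow> real) set \<Rightarrow> bool" where
  "equicontinuous H \<longleftrightarrow> (\<forall>x. \<forall>e>0. eventually (\<lambda>y. \<forall>h\<in>H. \<bar>h y - h x\<bar> < e) (nhds x))"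

lemma equicontinuous_pointwise_bounded:
  fixes H :: "('a::locally_convex_space \<Rightarrow> real) set"
  assumes H: "H \<subseteq> continuous_dual" "equicontinuous H"
  shows "\<exists>b>0. \<forall>h\<in>H. \<bar>h x\<bar> \<le> b"
proof -
  have "((\<lambda>n. (1 / real (Suc n)) *\<^sub>R x) \<longlongrightarrow> 0) sequentially"
    using tendsto_scaleR_lcs[OF LIMSEQ_inverse_real_of_nat tendsto_const, of x]
    by (simp add: divide_inverse)
  moreover have "eventually (\<lambda>y. \<forall>h\<in>H. \<bar>h y - h 0\<bar> < 1) (nhds 0)"
    using H(2) by (simp add: equicontinuous_def)
  ultimately have "eventually (\<lambda>n. \<forall>h\<in>H. \<bar>h ((1 / real (Suc n)) *\<^sub>R x) - h 0\<bar> < 1) sequentially"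
    by (rule eventually_compose_filterlim[rotated])
  then obtain n where n: "\<forall>h\<in>H. \<bar>h ((1 / real (Suc n)) *\<^sub>R x) - h 0\<bar> < 1"
    unfolding eventually_sequentially by blast
  have "\<bar>h x\<bar> \<le> real (Suc n)" if "h \<in> H" for h
  proof -
    have "h \<in> continuous_dual" using that H(1) by blast
    note arith = continuous_dual_arith[OF this]
    have "\<bar>(1 / real (Suc n)) * h x\<bar> < 1"
      using bspec[OF n that] by (simp only: arith diff_zero)
    then have "\<bar>h x\<bar> / real (Suc n) < 1" by (simp add: abs_mult)
    then show ?thesis by (simp only: divide_less_eq_1_pos of_nat_0_less_iff zero_less_Suc less_imp_le)
  qed
  then show ?thesis by (intro exI[of _ "real (Suc n)"]) auto
qed

text \<open>Lists of coefficient and index pairs make the countability immediate.\<close>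

definition rational_span :: "(nat \<Rightarrow> 'a::real_vector) \<Rightarrow> 'a set" where
  "rational_span a = range (\<lambda>l::(rat \<times> nat) list. \<Sum>(q, n)\<leftarrow>l. of_rat q *\<^sub>R a n)"

lemma countable_rational_span: "countable (rational_span a)"
  by (simp add: rational_span_def)

lemma rational_span_add:
  assumes "u \<in> rational_span a" "v \<in> rational_span a" shows "u + v \<in> rational_span a"
proof -
  obtain k l where "u = (\<Sum>(q, n)\<leftarrow>k. of_rat q *\<^sub>R a n)" "v = (\<Sum>(q, n)\<leftarrow>l. of_rat q *\<^sub>R a n)"
    using assms by (auto simp: rational_span_def)
  then have "u + v = (\<Sum>(q, n)\<leftarrow>k @ l. of_rat q *\<^sub>R a n)" by simp
  then show ?thesis unfolding rational_span_def by (rule range_eqI)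
qed

lemma rational_span_scale:
  assumes "u \<in> rational_span a" shows "of_rat r *\<^sub>R u \<in> rational_span a"
proof -
  obtain l where u: "u = (\<Sum>(q, n)\<leftarrow>l. of_rat q *\<^sub>R a n)"
    using assms by (auto simp: rational_span_def)
  have "of_rat r *\<^sub>R u = (\<Sum>(q, n)\<leftarrow>map (\<lambda>(q, n). (r * q, n)) l. of_rat q *\<^sub>R a n)"
    unfolding u by (induction l) (auto simp: scaleR_add_right of_rat_mult)
  then show ?thesis unfolding rational_span_def by (rule range_eqI)
qed

lemma rational_span_dense_in_span:
  fixes a :: "nat \<Rightarrow> 'a::locally_convex_space"
  assumes H: "H \<subseteq> continuous_dual" "equicontinuous H"
    and v: "v \<in> span (range a)" and e: "0 < e"
  shows "\<exists>d\<in>rational_span a. \<forall>h\<in>H. \<bar>h (v - d)\<bar> \<le> e"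
proof -
  note arith = continuous_dual_arith[OF subsetD[OF H(1)]]
  define W where "W = {v. \<forall>e>0. \<exists>d\<in>rational_span a. \<forall>h\<in>H. \<bar>h (v - d)\<bar> \<le> e}"
  have base: "a n \<in> W" for n
  proof -
    have "a n = (\<Sum>(q, n)\<leftarrow>[(1, n)]. of_rat q *\<^sub>R a n)" by simp
    then have "a n \<in> rational_span a" unfolding rational_span_def by (rule range_eqI)
    then show ?thesis unfolding W_def by (force simp: arith(1))
  qed
  have "subspace W"
  proof (rule subspaceI)
    have "0 = (\<Sum>(q, n)\<leftarrow>[]. of_rat q *\<^sub>R a n)" by simp
    then have "0 \<in> rational_span a" unfolding rational_span_def by (rule range_eqI)
    then show "0 \<in> W" unfolding W_def by (force simp: arith(1))
  next
    fix u v assume u: "u \<in> W" and v: "v \<in> W"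
    show "u + v \<in> W"
      unfolding W_def
    proof (intro CollectI allI impI)
      fix e :: real assume "0 < e"
      then have "0 < e / 2" by simp
      then obtain d d' where d: "d \<in> rational_span a" "\<forall>h\<in>H. \<bar>h (u - d)\<bar> \<le> e / 2"
        and d': "d' \<in> rational_span a" "\<forall>h\<in>H. \<bar>h (v - d')\<bar> \<le> e / 2"
        using u v unfolding W_def by blast
      have "\<bar>h (u + v - (d + d'))\<bar> \<le> e" if "h \<in> H" for h
      proof -
        have "h (u + v - (d + d')) = h (u - d) + h (v - d')" by (simp add: arith[OF that])
        then show ?thesis using bspec[OF d(2) that] bspec[OF d'(2) that] by linarith
      qed
      then show "\<exists>d\<in>rational_span a. \<forall>h\<in>H. \<bar>h (u + v - d)\<bar> \<le> e"
        using rational_span_add[OF d(1) d'(1)] by blast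
    qed
  next
    fix r :: real and v assume v: "v \<in> W"
    show "r *\<^sub>R v \<in> W"
      unfolding W_def
    proof (intro CollectI allI impI)
      fix e :: real assume e: "0 < e"
      obtain b where b: "0 < b" "\<And>h. h \<in> H \<Longrightarrow> \<bar>h v\<bar> \<le> b"
        using equicontinuous_pointwise_bounded[OF H] by blast
      have "r - e / (2 * b) < r" using e b by simp
      then obtain q :: rat where q: "r - e / (2 * b) < of_rat q" "of_rat q < r"
        using of_rat_dense by blast
      define s :: real where "s = of_rat q"
      have s: "\<bar>r - s\<bar> \<le> e / (2 * b)" using q by (simp add: s_def)
      have "0 < e / (2 * (\<bar>s\<bar> + 1))" using e by simp
      then obtain d where d: "d \<in> rational_span a" "\<forall>h\<in>H. \<bar>h (v - d)\<bar> \<le> e / (2 * (\<bar>s\<bar> + 1))"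
        using v unfolding W_def by blast
      have "\<bar>h (r *\<^sub>R v - s *\<^sub>R d)\<bar> \<le> e" if h: "h \<in> H" for h
      proof -
        have eq: "h (r *\<^sub>R v - s *\<^sub>R d) = (r - s) * h v + s * h (v - d)"
          by (simp add: arith[OF h] algebra_simps)
        have "\<bar>(r - s) * h v\<bar> \<le> e / (2 * b) * b"
          unfolding abs_mult using s b(2)[OF h] e b(1) by (intro mult_mono) auto
        also have "\<dots> = e / 2" using b by simp
        finally have 1: "\<bar>(r - s) * h v\<bar> \<le> e / 2" .
        have "\<bar>s * h (v - d)\<bar> \<le> (\<bar>s\<bar> + 1) * (e / (2 * (\<bar>s\<bar> + 1)))"
          unfolding abs_mult using d(2) h by (intro mult_mono) auto
        also have "\<dots> = e / 2" by (simp add: field_simps)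
        finally have "\<bar>s * h (v - d)\<bar> \<le> e / 2" .
        with 1 show ?thesis unfolding eq by linarith
      qed
      then show "\<exists>d\<in>rational_span a. \<forall>h\<in>H. \<bar>h (r *\<^sub>R v - d)\<bar> \<le> e"
        using rational_span_scale[OF d(1), of q] unfolding s_def by blast
    qed
  qed
  then have "span (range a) \<subseteq> W" using base by (intro span_minimal) auto
  then have "v \<in> W" using v by blast
  then show ?thesis using e by (auto simp: W_def)
qed

text \<open>Mazur's theorem for the span of a sequence, with the seminorm \<open>\<lambda>y. SUP h\<in>H. \<bar>h y\<bar>\<close>:
  the points at distance less than \<open>e\<close> from the span form an open convex set \<open>V\<close>, and a functional
  bounded above on \<open>V\<close> vanishes on the span, hence at \<open>x\<close>, so that none separates \<open>x\<close> from \<open>V\<close>.\<close>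

lemma approximation_by_rational_span:
  fixes a :: "nat \<Rightarrow> 'a::locally_convex_space"
  assumes H: "H \<subseteq> continuous_dual" "equicontinuous H" and e: "0 < e"
    and x: "\<And>f. f \<in> continuous_dual \<Longrightarrow> (\<And>n. f (a n) = 0) \<Longrightarrow> f x = 0"
  shows "\<exists>d\<in>rational_span a. \<forall>h\<in>H. \<bar>h (x - d)\<bar> \<le> e"
proof -
  note arith = continuous_dual_arith[OF subsetD[OF H(1)]]
  define V where "V = {y. \<exists>v\<in>span (range a). \<exists>\<eta><e. \<forall>h\<in>H. \<bar>h (y - v)\<bar> \<le> \<eta>}"
  have span_V: "v \<in> V" if "v \<in> span (range a)" for v
  proof -
    have "\<forall>h\<in>H. \<bar>h (v - v)\<bar> \<le> 0" by (simp add: arith(1))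
    then show ?thesis using that e unfolding V_def by blast
  qed
  have "open V"
    unfolding open_subopen[of V]
  proof
    fix y assume "y \<in> V"
    then obtain v \<eta> where v: "v \<in> span (range a)" "\<eta> < e" "\<forall>h\<in>H. \<bar>h (y - v)\<bar> \<le> \<eta>"
      by (auto simp: V_def)
    define \<delta> where "\<delta> = (e - \<eta>) / 2"
    have \<delta>: "0 < \<delta>" "\<eta> + \<delta> < e" using v(2) by (auto simp: \<delta>_def field_simps)
    have "eventually (\<lambda>z. \<forall>h\<in>H. \<bar>h z - h y\<bar> < \<delta>) (nhds y)"
      using H(2) \<delta>(1) by (simp add: equicontinuous_def)
    then obtain T where T: "open T" "y \<in> T" "\<forall>z\<in>T. \<forall>h\<in>H. \<bar>h z - h y\<bar> < \<delta>"
      unfolding eventually_nhds by blast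
    have "z \<in> V" if z: "z \<in> T" for z
    proof -
      have "\<bar>h (z - v)\<bar> \<le> \<eta> + \<delta>" if h: "h \<in> H" for h
      proof -
        have "h (z - v) = h (y - v) + (h z - h y)" by (simp add: arith[OF h])
        then show ?thesis using bspec[OF v(3) h] bspec[OF bspec[OF T(3) z] h] by linarith
      qed
      then show ?thesis using v(1) \<delta>(2) by (auto simp: V_def)
    qed
    then show "\<exists>T. open T \<and> y \<in> T \<and> T \<subseteq> V" using T by blast
  qed
  moreover have "convex V"
  proof (rule convexI)
    fix y z and s t :: real assume y: "y \<in> V" and z: "z \<in> V" and st: "0 \<le> s" "0 \<le> t" "s + t = 1"
    obtain v \<eta> where v: "v \<in> span (range a)" "\<eta> < e" "\<forall>h\<in>H. \<bar>h (y - v)\<bar> \<le> \<eta>"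
      using y by (auto simp: V_def)
    obtain w \<theta> where w: "w \<in> span (range a)" "\<theta> < e" "\<forall>h\<in>H. \<bar>h (z - w)\<bar> \<le> \<theta>"
      using z by (auto simp: V_def)
    have "\<bar>h (s *\<^sub>R y + t *\<^sub>R z - (s *\<^sub>R v + t *\<^sub>R w))\<bar> \<le> max \<eta> \<theta>" if h: "h \<in> H" for h
    proof -
      have "h (s *\<^sub>R y + t *\<^sub>R z - (s *\<^sub>R v + t *\<^sub>R w)) = s * h (y - v) + t * h (z - w)"
        by (simp add: arith[OF h] algebra_simps)
      also have "\<bar>\<dots>\<bar> \<le> s * \<bar>h (y - v)\<bar> + t * \<bar>h (z - w)\<bar>"
        using st abs_triangle_ineq[of "s * h (y - v)" "t * h (z - w)"] by (simp add: abs_mult)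
      also have "\<dots> \<le> s * max \<eta> \<theta> + t * max \<eta> \<theta>"
        using st v(3) w(3) h by (intro add_mono mult_left_mono) (auto simp: le_max_iff_disj)
      also have "\<dots> = max \<eta> \<theta>" using st by (simp add: distrib_right[symmetric])
      finally show ?thesis .
    qed
    moreover have "s *\<^sub>R v + t *\<^sub>R w \<in> span (range a)"
      using v w by (intro span_add span_scale)
    moreover have "max \<eta> \<theta> < e" using v w by simp
    ultimately show "s *\<^sub>R y + t *\<^sub>R z \<in> V" unfolding V_def by blast
  qed
  moreover have "0 \<in> V" by (rule span_V) (rule span_zero)
  moreover have False if f: "f \<in> continuous_dual" "\<And>v. v \<in> V \<Longrightarrow> f v \<le> 1" "1 \<le> f x" for f
  proof -
    have "f (a n) = 0" for n
    proof (rule ccontr)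
      assume "f (a n) \<noteq> 0"
      then have "f ((2 / f (a n)) *\<^sub>R a n) = 2"
        by (simp add: continuous_dual_arith[OF f(1)])
      moreover have "(2 / f (a n)) *\<^sub>R a n \<in> V"
        by (intro span_V span_scale span_base) simp
      ultimately show False using f(2)[of "(2 / f (a n)) *\<^sub>R a n"] by simp
    qed
    then show False using x[OF f(1)] f(3) by simp
  qed
  ultimately have "x \<in> V" using hahn_banach_open_convex[of V x] by blast
  then obtain v \<eta> where v: "v \<in> span (range a)" "\<eta> < e" "\<forall>h\<in>H. \<bar>h (x - v)\<bar> \<le> \<eta>"
    by (auto simp: V_def)
  have "0 < e - \<eta>" using v by simp
  then obtain d where d: "d \<in> rational_span a" "\<forall>h\<in>H. \<bar>h (v - d)\<bar> \<le> e - \<eta>"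
    using rational_span_dense_in_span[OF H v(1)] by blast
  have "\<bar>h (x - d)\<bar> \<le> e" if h: "h \<in> H" for h
  proof -
    have "h (x - d) = h (x - v) + h (v - d)" by (simp add: arith[OF h])
    then show ?thesis using bspec[OF v(3) h] bspec[OF d(2) h] by linarith
  qed
  then show ?thesis using d(1) by blast
qed

section \<open>Small slices of weakly compact sets\<close>

text \<open>\<open>M\<close> is a set of evaluations; the condition says that the support function of \<open>M\<close> is at least
  that of \<open>S\<close>. For compact \<open>M\<close> inside the image of \<open>S\<close> it means that \<open>S\<close> lies in the closed convex
  hull of \<open>M\<close>.\<close>

definition supports :: "'a::locally_convex_space set \<Rightarrow> (('a \<Rightarrow> real) \<Rightarrow> real) set \<Rightarrow> bool" where
  "supports S M \<longleftrightarrow> (\<forall>f\<in>continuous_dual. \<forall>x\<in>S. \<exists>y\<in>M. f x \<le> y f)"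

lemma Hausdorff_space_fun: "Hausdorff_space (euclidean :: ('b \<Rightarrow> 'c::metric_space) topology)"
proof -
  have "Hausdorff_space (product_topology (\<lambda>_::'b. euclidean :: 'c topology) UNIV)"
    by (simp add: Hausdorff_space_product_topology)
  then show ?thesis by (simp only: euclidean_product_topology)
qed

lemma compact_fun_imp_closed: "compact K \<Longrightarrow> closed (K :: ('b \<Rightarrow> 'c::metric_space) set)"
  using compactin_imp_closedin[OF Hausdorff_space_fun, of K] by simp

text \<open>Such a minimal set plays the role of the closure of the extreme points. The intersection of a
  chain of supporting sets is supporting, because by compactness the closed half-spaces
  \<open>{y. f x \<le> y f}\<close> that meet every member of the chain meet the intersection.\<close>

lemma minimal_supporting_set:
  fixes S :: "'a::locally_convex_space set"
  assumes S: "compact (evaluation ` S)"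
  shows "\<exists>M\<subseteq>evaluation ` S. closed M \<and> supports S M \<and>
    (\<forall>M'\<subseteq>M. closed M' \<longrightarrow> supports S M' \<longrightarrow> M' = M)"
proof -
  define A where "A = {M. M \<subseteq> evaluation ` S \<and> closed M \<and> supports S M}"
  have "\<exists>m\<in>A. \<forall>a\<in>A. m \<supseteq> a \<longrightarrow> a = m"
  proof (rule predicate_Zorn)
    show "partial_order_on A (relation_of (\<supseteq>) A)"
      by (rule partial_order_on_relation_ofI) auto
  next
    fix P assume "P \<in> Chains (relation_of (\<supseteq>) A)"
    then have PA: "P \<subseteq> A" and ch: "\<And>a b. a \<in> P \<Longrightarrow> b \<in> P \<Longrightarrow> a \<subseteq> b \<or> b \<subseteq> a"
      unfolding Chains_def relation_of_def by auto
    show "\<exists>u\<in>A. \<forall>a\<in>P. u \<subseteq> a"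
    proof (cases "P = {}")
      case True
      have "supports S (evaluation ` S)"
        unfolding supports_def by (auto simp: evaluation_def intro: bexI[rotated])
      then have "evaluation ` S \<in> A" using compact_fun_imp_closed[OF S] by (simp add: A_def)
      then show ?thesis using True by blast
    next
      case False
      have "supports S (\<Inter>P)"
        unfolding supports_def
      proof (intro ballI)
        fix f :: "'a \<Rightarrow> real" and x assume f: "f \<in> continuous_dual" and x: "x \<in> S"
        define L where "L = {y :: ('a \<Rightarrow> real) \<Rightarrow> real. f x \<le> y f}"
        have L: "closed L"
          unfolding L_def by (intro closed_Collect_le continuous_on_const continuous_coordinate)
        have "evaluation ` S \<inter> (\<Inter>m\<in>P. m \<inter> L) \<noteq> {}"
        proof (rule compact_imp_fip_image[OF S])
          show "closed (m \<inter> L)" if "m \<in> P" for m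
            using that PA L by (auto simp: A_def)
        next
          fix Q assume Q: "finite Q" "Q \<subseteq> P"
          have "\<exists>m\<in>P. \<forall>q\<in>Q. m \<subseteq> q"
            using Q
          proof (induction rule: finite_induct)
            case empty
            then show ?case using False by blast
          next
            case (insert q Q)
            then obtain m where m: "m \<in> P" "\<forall>q\<in>Q. m \<subseteq> q" by blast
            have "m \<subseteq> q \<or> q \<subseteq> m" using ch m(1) insert.prems by blast
            then show ?case using m insert.prems by blast
          qed
          then obtain m where m: "m \<in> P" "\<forall>q\<in>Q. m \<subseteq> q" by blast
          then have "supports S m" "m \<subseteq> evaluation ` S" using PA by (auto simp: A_def)
          then obtain y where y: "y \<in> m" "f x \<le> y f" "y \<in> evaluation ` S"
            using f x unfolding supports_def by (metis subsetD)
          have "y \<in> q \<inter> L" if "q \<in> Q" for q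
            using that m(2) y(1,2) by (auto simp: L_def)
          then show "evaluation ` S \<inter> (\<Inter>q\<in>Q. q \<inter> L) \<noteq> {}" using y(3) by auto
        qed
        then obtain y where "y \<in> (\<Inter>m\<in>P. m \<inter> L)" by (metis Int_iff equals0I)
        then have y: "y \<in> m \<inter> L" if "m \<in> P" for m using that by (rule INT_D)
        then have "y \<in> L" using False by blast
        moreover have "y \<in> \<Inter>P" using y by simp
        ultimately show "\<exists>y\<in>\<Inter>P. f x \<le> y f" by (auto simp: L_def)
      qed
      moreover have "closed (\<Inter>P)" using PA by (intro closed_Inter) (auto simp: A_def)
      moreover have "\<Inter>P \<subseteq> evaluation ` S"
      proof -
        obtain m where "m \<in> P" using False by blast
        then have "\<Inter>P \<subseteq> m" "m \<subseteq> evaluation ` S" using PA by (blast, auto simp: A_def)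
        then show ?thesis by (rule order_trans)
      qed
      ultimately have "\<Inter>P \<in> A" by (simp add: A_def)
      then show ?thesis by blast
    qed
  qed
  then obtain M where M: "M \<in> A" and min: "\<And>M'. M' \<in> A \<Longrightarrow> M' \<subseteq> M \<Longrightarrow> M' = M" by blast
  show ?thesis
  proof (intro exI[of _ M] conjI allI impI)
    show "M' = M" if "M' \<subseteq> M" "closed M'" "supports S M'" for M'
      using min[of M'] that M by (auto simp: A_def)
  qed (use M in \<open>auto simp: A_def\<close>)
qed

lemma countable_closed_cover_interior:
  fixes M :: "('b \<Rightarrow> real) set"
  assumes M: "compact M" "M \<noteq> {}" and D: "countable D"
    and cl: "\<And>d. d \<in> D \<Longrightarrow> closed (N d)" and cov: "M \<subseteq> (\<Union>d\<in>D. N d)"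
  shows "\<exists>d\<in>D. \<exists>W. open W \<and> M \<inter> W \<noteq> {} \<and> M \<inter> W \<subseteq> N d"
proof (rule ccontr)
  assume no: "\<not> ?thesis"
  let ?X = "subtopology euclidean M"
  have "compact_space ?X" using M(1) by (simp add: compact_space_subtopology)
  moreover have "Hausdorff_space ?X" by (intro Hausdorff_space_subtopology Hausdorff_space_fun)
  ultimately have X: "locally_compact_space ?X \<and> regular_space ?X"
    by (simp add: compact_imp_locally_compact_space compact_Hausdorff_imp_regular_space)
  have "?X interior_of (\<Union>d\<in>D. M \<inter> N d) = {}"
  proof (rule Baire_category_alt)
    show "completely_metrizable_space ?X \<or> locally_compact_space ?X \<and> regular_space ?X" using X ..
    show "countable ((\<lambda>d. M \<inter> N d) ` D)" using D by simp
    fix T assume "T \<in> (\<lambda>d. M \<inter> N d) ` D"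
    then obtain d where d: "d \<in> D" "T = M \<inter> N d" by blast
    have "closedin ?X T" using cl[OF d(1)] d(2) by (auto simp: closedin_subtopology)
    moreover have "?X interior_of T = {}"
    proof (rule ccontr)
      assume "?X interior_of T \<noteq> {}"
      moreover obtain W where "open W" "?X interior_of T = M \<inter> W"
        using openin_interior_of[of ?X T] unfolding openin_open by blast
      moreover have "?X interior_of T \<subseteq> N d"
        using interior_of_subset[of ?X T] d(2) by blast
      ultimately show False using no d(1) by blast
    qed
    ultimately show "closedin ?X T \<and> ?X interior_of T = {}" ..
  qed
  moreover have "(\<Union>d\<in>D. M \<inter> N d) = M" using cov by blast
  moreover have "?X interior_of M = M"
    using interior_of_topspace[of ?X] by simp
  ultimately show False using M(2) by simp
qed

text \<open>By the Baire property, a relatively open part \<open>M \<inter> W\<close> of a minimal supporting set \<open>M\<close> lies in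
  one of the countably many balls of radius \<open>e\<close> that cover \<open>S\<close>, say the one about \<open>d\<close>. By minimality
  \<open>M - W\<close> is not supporting, so some \<open>f\<close> has supremum at most \<open>a < m\<close> on it, where \<open>m\<close> is the
  supremum over \<open>S\<close>. On \<open>M\<close>, a functional \<open>h\<close> of the family deviates from \<open>h d\<close> by at most \<open>e\<close> inside
  \<open>W\<close>, and by at most some \<open>L\<close> outside, where however \<open>m - f\<close> is at least \<open>m - a\<close>. With
  \<open>c = L / (m - a)\<close> the functional \<open>h + c f\<close> is therefore at most \<open>h d + e + c m\<close> on all of \<open>M\<close>, and
  this bound passes to \<open>S\<close> because \<open>M\<close> is supporting.\<close>

theorem small_slices:
  fixes S :: "'a::locally_convex_space set"
  assumes S: "compact (evaluation ` S)" "S \<noteq> {}" and H: "H \<subseteq> continuous_dual"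
    and D: "countable D" "\<forall>x\<in>S. \<exists>d\<in>D. \<forall>h\<in>H. \<bar>h (x - d)\<bar> \<le> e" and e: "0 \<le> e"
    and R: "\<forall>x\<in>S. \<forall>h\<in>H. \<bar>h x\<bar> \<le> R"
  shows "\<exists>f\<in>continuous_dual. \<exists>d. \<exists>c\<ge>0. \<exists>m. (\<forall>u. (\<forall>x\<in>S. f x \<le> u) \<longrightarrow> m \<le> u) \<and>
    (\<forall>x\<in>S. f x \<le> m \<and> (\<forall>h\<in>H. \<bar>h (x - d)\<bar> \<le> e + c * (m - f x)))"
proof -
  note arith = continuous_dual_arith[OF subsetD[OF H]]
  obtain M where MS: "M \<subseteq> evaluation ` S" and M: "closed M" "supports S M"
    and min: "\<And>M'. M' \<subseteq> M \<Longrightarrow> closed M' \<Longrightarrow> supports S M' \<Longrightarrow> M' = M"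
    using minimal_supporting_set[OF S(1)] by blast
  have "compact M" using compact_Int_closed[OF S(1) M(1)] MS by (simp add: inf.absorb2)
  have "M \<noteq> {}"
    using M(2) S(2) continuous_dual_zero unfolding supports_def by blast
  define N where "N d = (\<Inter>h\<in>H. {y :: ('a \<Rightarrow> real) \<Rightarrow> real. \<bar>y h - h d\<bar> \<le> e})" for d
  have N: "closed (N d)" for d
    unfolding N_def
    by (intro closed_INT ballI closed_Collect_le continuous_intros continuous_coordinate)
  have cover: "M \<subseteq> (\<Union>d\<in>D. N d)"
  proof
    fix y assume "y \<in> M"
    then obtain x where x: "x \<in> S" "y = evaluation x" using MS by blast
    obtain d where d: "d \<in> D" "\<forall>h\<in>H. \<bar>h (x - d)\<bar> \<le> e" using bspec[OF D(2) x(1)] by blast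
    have "\<bar>y h - h d\<bar> \<le> e" if "h \<in> H" for h
      using bspec[OF d(2) that] subsetD[OF H that] by (simp add: arith(3)[OF that] x(2) evaluation_def)
    then show "y \<in> (\<Union>d\<in>D. N d)" using d(1) by (auto simp: N_def)
  qed
  obtain d W where W: "open W" "M \<inter> W \<noteq> {}" "M \<inter> W \<subseteq> N d"
    using countable_closed_cover_interior[OF \<open>compact M\<close> \<open>M \<noteq> {}\<close> D(1) N cover] by blast
  have "M - W \<noteq> M" using W(2) by blast
  moreover have "closed (M - W)" using M(1) W(1) by (intro closed_Diff)
  ultimately have "\<not> supports S (M - W)" using min[of "M - W"] by blast
  then obtain f x1 where f: "f \<in> continuous_dual" and x1: "x1 \<in> S"
    and less: "\<And>y. y \<in> M - W \<Longrightarrow> y f < f x1"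
    unfolding supports_def by (metis not_le)
  have "\<exists>a<f x1. \<forall>y\<in>M - W. y f \<le> a"
  proof (cases "M - W = {}")
    case True
    then show ?thesis by (intro exI[of _ "f x1 - 1"]) auto
  next
    case False
    have "compact (M - W)" using \<open>compact M\<close> W(1) by (rule compact_diff)
    from continuous_attains_sup[OF this False continuous_coordinate[of _ f]] less
    show ?thesis by blast
  qed
  then obtain a where a: "a < f x1" "\<And>y. y \<in> M - W \<Longrightarrow> y f \<le> a" by blast
  define m where "m = Sup (f ` S)"
  have "compact ((\<lambda>y. y f) ` evaluation ` S)"
    by (rule compact_continuous_image[OF continuous_coordinate S(1)])
  also have "(\<lambda>y. y f) ` evaluation ` S = f ` S"
    using f by (auto simp: evaluation_def image_image)
  finally have "bdd_above (f ` S)" by (intro bounded_imp_bdd_above compact_imp_bounded)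
  then have f_le: "f x \<le> m" if "x \<in> S" for x
    unfolding m_def using that by (rule cSUP_upper[rotated])
  have m_le: "m \<le> u" if "\<forall>x\<in>S. f x \<le> u" for u
    unfolding m_def using S(2) that by (intro cSUP_least) auto
  have am: "a < m" using a(1) f_le[OF x1] by simp
  define L where "L = 2 * \<bar>R\<bar> + e"
  define c where "c = L / (m - a)"
  have L0: "0 \<le> L" using e by (simp add: L_def)
  have c0: "0 \<le> c" using L0 am by (simp add: c_def)
  have ca: "c * (m - a) = L" using am by (simp add: c_def)
  have hd: "\<bar>h d\<bar> \<le> \<bar>R\<bar> + e" if h: "h \<in> H" for h
  proof -
    obtain y where y: "y \<in> M" "y \<in> N d" using W(2,3) by blast
    obtain x where x: "x \<in> S" "y = evaluation x" using y(1) MS by blast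
    have "\<bar>h x - h d\<bar> \<le> e"
      using y(2) h subsetD[OF H h] by (auto simp: N_def x(2) evaluation_def)
    then show ?thesis using bspec[OF bspec[OF R x(1)] h] by linarith
  qed
  \<comment> \<open>The sign \<open>s\<close> covers \<open>h\<close> and \<open>- h\<close> at once.\<close>
  have key: "s * h (x - d) \<le> e + c * (m - f x)" if x: "x \<in> S" and h: "h \<in> H" and s: "\<bar>s\<bar> = 1" for x h s
  proof -
    have hE: "h \<in> continuous_dual" using H h by blast
    define k where "k = (\<lambda>x. s * h x + c * f x)"
    have k: "k \<in> continuous_dual" unfolding k_def by (rule continuous_dual_lincomb[OF hE f])
    then obtain y where y: "y \<in> M" "k x \<le> y k" using M(2) x unfolding supports_def by blast
    obtain z where z: "z \<in> S" "y = evaluation z" using y(1) MS by blast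
    have yv: "y k = s * h z + c * f z" "y f = f z" "y h = h z"
      using k hE f by (simp_all add: z(2) evaluation_def k_def)
    have abs: "s * t \<le> \<bar>t\<bar>" for t
      using s by (metis abs_ge_self abs_mult mult_1)
    have "s * (h z - h d) + c * f z \<le> e + c * m"
    proof (cases "y \<in> W")
      case True
      then have "y \<in> N d" using W(3) y(1) by blast
      then have "\<bar>h z - h d\<bar> \<le> e" using h yv(3) by (metis (mono_tags, lifting) INT_iff N_def mem_Collect_eq)
      moreover have "c * f z \<le> c * m" using f_le[OF z(1)] c0 by (rule mult_left_mono)
      ultimately show ?thesis using abs[of "h z - h d"] by linarith
    next
      case False
      then have "c * f z \<le> c * a" using a(2)[of y] y(1) yv(2) c0 by (simp add: mult_left_mono)
      moreover have "\<bar>h z - h d\<bar> \<le> L" using bspec[OF bspec[OF R z(1)] h] hd[OF h] unfolding L_def by linarith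
      moreover have "c * a + L = c * m" using ca by (simp add: algebra_simps)
      ultimately show ?thesis using abs[of "h z - h d"] e by linarith
    qed
    moreover have "s * h x + c * f x \<le> s * h z + c * f z" using y(2) yv(1) by (simp add: k_def)
    ultimately show ?thesis by (simp add: arith(3)[OF h] algebra_simps)
  qed
  have "\<bar>h (x - d)\<bar> \<le> e + c * (m - f x)" if "x \<in> S" "h \<in> H" for x h
    using key[OF that, of 1] key[OF that, of "-1"] by simp
  then show ?thesis using f c0 f_le m_le by blast
qed

section \<open>Equicontinuous representations on cones\<close>

text \<open>An enumeration with repetitions is enough: the weight of a group element in the averages below
  only has to be positive.\<close>

locale equicontinuous_cone_rep =
  fixes G :: "('g, 'm) monoid_scheme" (structure)
    and \<rho> :: "'g \<Rightarrow> 'a \<Rightarrow> 'a::{locally_convex_space, t2_space}"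
    and C :: "'a set"
    and enum :: "nat \<Rightarrow> 'g"
  assumes group: "group G"
    and rep: "cone_representation G \<rho> C"
    and equi: "equicontinuous_rep G \<rho>"
    and complete: "weakly_complete C"
    and cone: "convex_cone C"
    and enum: "range enum = carrier G"
begin

sublocale group G by (rule group)

lemma enum_carrier [simp]: "enum n \<in> carrier G"
  using enum by blast

lemma rep_linear: "g \<in> carrier G \<Longrightarrow> linear (\<rho> g)"
  and rep_cont: "g \<in> carrier G \<Longrightarrow> continuous_on UNIV (\<rho> g)"
  and rep_cone: "g \<in> carrier G \<Longrightarrow> c \<in> C \<Longrightarrow> \<rho> g c \<in> C"
  using rep by (auto simp: cone_representation_def)

lemma rep_action: "group_action G UNIV \<rho>"
  using rep by (simp add: cone_representation_def)

lemma rep_mult: "g \<in> carrier G \<Longrightarrow> h \<in> carrier G \<Longrightarrow> \<rho> (g \<otimes> h) x = \<rho> g (\<rho> h x)"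
  using group_action.composition_rule[OF rep_action] by simp

lemma rep_one: "\<rho> \<one> x = x"
  using group_action.id_eq_one[OF rep_action] by (metis UNIV_I restrict_apply)

lemma rep_inv: "g \<in> carrier G \<Longrightarrow> \<rho> (inv g) (\<rho> g x) = x"
  by (simp add: rep_mult[symmetric] rep_one)

lemma translate_dual:
  assumes "f \<in> continuous_dual" "g \<in> carrier G"
  shows "(\<lambda>x. f (\<rho> g x)) \<in> continuous_dual"
  using assms linear_compose[OF rep_linear[OF assms(2)], of f]
    continuous_on_compose2[OF _ rep_cont[OF assms(2)], of UNIV f]
  by (simp add: continuous_dual_def o_def)

definition orbit_functionals :: "('a \<Rightarrow> real) \<Rightarrow> ('a \<Rightarrow> real) set" where
  "orbit_functionals f = (\<lambda>g x. f (\<rho> g x)) ` carrier G"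

lemma orbit_functionals_dual: "f \<in> continuous_dual \<Longrightarrow> orbit_functionals f \<subseteq> continuous_dual"
  by (auto simp: orbit_functionals_def translate_dual)

lemma equicontinuous_orbit_functionals:
  assumes f: "f \<in> continuous_dual"
  shows "equicontinuous (orbit_functionals f)"
  unfolding equicontinuous_def
proof (intro allI impI)
  fix x and e :: real assume e: "0 < e"
  have "open {z. \<bar>f z\<bar> < e}"
    using f by (intro open_Collect_less continuous_intros) (simp_all add: continuous_dual_def)
  moreover have "0 \<in> {z. \<bar>f z\<bar> < e}" using e by (simp add: continuous_dual_arith[OF f])
  ultimately have "eventually (\<lambda>y. \<forall>g\<in>carrier G. \<rho> g y - \<rho> g x \<in> {z. \<bar>f z\<bar> < e}) (nhds x)"
    using equi unfolding equicontinuous_rep_def by blast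
  then show "eventually (\<lambda>y. \<forall>h\<in>orbit_functionals f. \<bar>h y - h x\<bar> < e) (nhds x)"
    by (rule eventually_mono) (simp add: orbit_functionals_def continuous_dual_arith[OF f])
qed

lemma orbit_bounded:
  assumes f: "f \<in> continuous_dual"
  shows "\<exists>b>0. \<forall>g\<in>carrier G. \<bar>f (\<rho> g x)\<bar> \<le> b"
  using equicontinuous_pointwise_bounded[OF orbit_functionals_dual equicontinuous_orbit_functionals, OF f f, of x]
  by (simp add: orbit_functionals_def)

text \<open>The transpose of the averaging operator \<open>\<Sum>n. 2\<^sup>-\<^sup>n\<^sup>-\<^sup>1 \<rho> (enum n)\<close>.\<close>

definition average :: "('a \<Rightarrow> real) \<Rightarrow> 'a \<Rightarrow> real" where
  "average f x = (\<Sum>n. (1 / 2) ^ Suc n * f (\<rho> (enum n) x))"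

lemma average_summable:
  assumes f: "f \<in> continuous_dual"
  shows "summable (\<lambda>n. (1 / 2) ^ Suc n * f (\<rho> (enum n) x))"
proof -
  obtain b where b: "0 < b" "\<forall>g\<in>carrier G. \<bar>f (\<rho> g x)\<bar> \<le> b" using orbit_bounded[OF f] by blast
  show ?thesis
  proof (rule summable_comparison_test)
    show "summable (\<lambda>n. (1 / 2) ^ Suc n * b)"
      using power_half_series by (intro summable_mult2) (rule sums_summable)
    show "\<exists>N. \<forall>n\<ge>N. norm ((1 / 2) ^ Suc n * f (\<rho> (enum n) x)) \<le> (1 / 2) ^ Suc n * b"
      using b(2) by (auto simp: abs_mult intro!: mult_left_mono)
  qed
qed

lemma average_sums: "f \<in> continuous_dual \<Longrightarrow> (\<lambda>n. (1 / 2) ^ Suc n * f (\<rho> (enum n) x)) sums average f x"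
  unfolding average_def by (intro summable_sums average_summable)

lemma average_minus:
  assumes f: "f \<in> continuous_dual" shows "average (\<lambda>x. - f x) x = - average f x"
  unfolding average_def using suminf_minus[OF average_summable[OF f, of x]] by simp

text \<open>If a mean of numbers \<open>\<le> m\<close> is close to \<open>m\<close>, then so is each number of positive weight.\<close>

lemma average_gap:
  assumes f: "f \<in> continuous_dual" and m: "\<And>g. g \<in> carrier G \<Longrightarrow> f (\<rho> g x) \<le> m"
  shows "(1 / 2) ^ Suc k * (m - f (\<rho> (enum k) x)) \<le> m - average f x"
proof -
  have "(\<lambda>n. (1 / 2) ^ Suc n * m - (1 / 2) ^ Suc n * f (\<rho> (enum n) x)) sums (1 * m - average f x)"
    by (intro sums_diff sums_mult2 power_half_series average_sums f)
  then have "(\<lambda>n. (1 / 2) ^ Suc n * (m - f (\<rho> (enum n) x))) sums (m - average f x)"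
    by (simp only: right_diff_distrib mult_1)
  from sum_le_suminf[OF sums_summable[OF this], of "{k}"] sums_unique[OF this] m
  show ?thesis by simp
qed

lemma average_le:
  assumes f: "f \<in> continuous_dual" and m: "\<And>g. g \<in> carrier G \<Longrightarrow> f (\<rho> g x) \<le> m"
  shows "average f x \<le> m"
proof -
  have "0 \<le> (1 / 2) ^ Suc 0 * (m - f (\<rho> (enum 0) x))" using m[of "enum 0"] by simp
  then show ?thesis using average_gap[OF f m, of 0] by linarith
qed

lemma minus_dual: "f \<in> continuous_dual \<Longrightarrow> (\<lambda>x. - f x) \<in> continuous_dual"
  using continuous_dual_lincomb[of f f "-1" 0] by simp

text \<open>This is where equicontinuity enters: one neighbourhood of \<open>0\<close> serves all terms of the series.\<close>

lemma average_dual: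
  assumes f: "f \<in> continuous_dual" shows "average f \<in> continuous_dual"
proof (rule continuous_dualI)
  show "linear (average f)"
  proof (rule linearI)
    fix x y
    have "(\<lambda>n. (1 / 2) ^ Suc n * f (\<rho> (enum n) x) + (1 / 2) ^ Suc n * f (\<rho> (enum n) y)) sums
      (average f x + average f y)"
      by (intro sums_add average_sums f)
    then have "(\<lambda>n. (1 / 2) ^ Suc n * f (\<rho> (enum n) (x + y))) sums (average f x + average f y)"
      by (simp only: continuous_dual_arith[OF translate_dual[OF f enum_carrier]] distrib_left)
    then show "average f (x + y) = average f x + average f y"
      unfolding average_def by (rule sums_unique[symmetric])
  next
    fix r x
    have "(\<lambda>n. r * ((1 / 2) ^ Suc n * f (\<rho> (enum n) x))) sums (r * average f x)"
      by (intro sums_mult average_sums f)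
    then have "(\<lambda>n. (1 / 2) ^ Suc n * f (\<rho> (enum n) (r *\<^sub>R x))) sums (r * average f x)"
      by (simp only: continuous_dual_arith[OF translate_dual[OF f enum_carrier]] mult.left_commute)
    then show "average f (r *\<^sub>R x) = r *\<^sub>R average f x"
      unfolding average_def real_scaleR_def by (rule sums_unique[symmetric])
  qed
  have "eventually (\<lambda>y. \<forall>h\<in>orbit_functionals f. \<bar>h y - h 0\<bar> < 1) (nhds 0)"
    using equicontinuous_orbit_functionals[OF f] unfolding equicontinuous_def by (meson zero_less_one)
  then show "eventually (\<lambda>y. \<bar>average f y\<bar> \<le> 1) (nhds 0)"
  proof (rule eventually_mono)
    fix y assume y: "\<forall>h\<in>orbit_functionals f. \<bar>h y - h 0\<bar> < 1"
    have le: "\<bar>f (\<rho> g y)\<bar> < 1" if "g \<in> carrier G" for g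
    proof -
      have "(\<lambda>x. f (\<rho> g x)) \<in> orbit_functionals f" using that by (simp add: orbit_functionals_def)
      from bspec[OF y this] show ?thesis
        by (simp add: continuous_dual_arith(1)[OF translate_dual[OF f that]])
    qed
    have "average f y \<le> 1"
    proof (rule average_le[OF f])
      show "f (\<rho> g y) \<le> 1" if "g \<in> carrier G" for g using le[OF that] by simp
    qed
    moreover have "average (\<lambda>x. - f x) y \<le> 1"
    proof (rule average_le[OF minus_dual[OF f]])
      show "- f (\<rho> g y) \<le> 1" if "g \<in> carrier G" for g using le[OF that] by simp
    qed
    ultimately show "\<bar>average f y\<bar> \<le> 1" by (simp add: average_minus[OF f])
  qed
qed

lemma average_point:
  assumes c: "c \<in> C"
  shows "\<exists>y\<in>C. \<forall>f\<in>continuous_dual. f y = average f c"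
proof -
  have eq: "f ((1 / 2) ^ Suc n *\<^sub>R \<rho> (enum n) c) = (1 / 2) ^ Suc n * f (\<rho> (enum n) c)"
    if "f \<in> continuous_dual" for f n
    by (rule continuous_dual_arith(4)[OF that])
  have "\<exists>y\<in>C. \<forall>f\<in>continuous_dual. (\<lambda>n. f ((1 / 2) ^ Suc n *\<^sub>R \<rho> (enum n) c)) sums f y"
  proof (rule weakly_convergent_series[OF complete cone])
    show "(1 / 2) ^ Suc n *\<^sub>R \<rho> (enum n) c \<in> C" for n
      by (rule convex_cone_scaleR[OF cone _ rep_cone[OF enum_carrier c]]) simp
    show "summable (\<lambda>n. f ((1 / 2) ^ Suc n *\<^sub>R \<rho> (enum n) c))" if "f \<in> continuous_dual" for f
      by (simp only: eq[OF that] average_summable[OF that])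
  qed
  then obtain y where y: "y \<in> C"
    "\<And>f. f \<in> continuous_dual \<Longrightarrow> (\<lambda>n. f ((1 / 2) ^ Suc n *\<^sub>R \<rho> (enum n) c)) sums f y" by blast
  have "f y = average f c" if "f \<in> continuous_dual" for f
    using y(2)[OF that] average_sums[OF that, of c] unfolding eq[OF that] by (rule sums_unique2)
  then show ?thesis using y(1) by blast
qed

text \<open>An order unit of the dual for the order given by \<open>C\<close>.\<close>

definition order_unit :: "('a \<Rightarrow> real) \<Rightarrow> bool" where
  "order_unit \<psi> \<longleftrightarrow> \<psi> \<in> continuous_dual \<and> (\<forall>c\<in>C. 0 \<le> \<psi> c) \<and>
    (\<forall>f\<in>continuous_dual. \<exists>k\<ge>0. \<forall>c\<in>C. \<bar>f c\<bar> \<le> k * \<psi> c)"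

text \<open>The cobounding functional \<open>\<phi>\<close> is below the non-negative sum \<open>\<phi>1\<close> of translates that dominates
  \<open>\<phi>\<close> itself, and the average of \<open>\<phi>1\<close> dominates each translate of \<open>\<phi>1\<close> up to the
  reciprocal of its weight.\<close>

lemma cobounded_imp_order_unit:
  assumes "cobounded_type G \<rho> C"
  shows "\<exists>\<psi>. order_unit \<psi>"
proof -
  obtain \<phi> where \<phi>: "\<phi> \<in> continuous_dual" and
    dom: "\<And>f. f \<in> continuous_dual \<Longrightarrow> \<exists>(n::nat) g. (\<forall>i\<in>{1..n}. g i \<in> carrier G) \<and>
      (\<forall>c\<in>C. \<bar>f c\<bar> \<le> (\<Sum>i=1..n. \<phi> (\<rho> (inv (g i)) c)))"
  proof -
    from assms obtain \<phi> where \<phi>: "\<phi> \<in> continuous_dual" and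
      *: "\<forall>f\<in>continuous_dual. \<exists>(n::nat) g. (\<forall>i\<in>{1..n}. g i \<in> carrier G) \<and>
      dual_le C f (\<lambda>x. \<Sum>i=1..n. dual_action G \<rho> (g i) \<phi> x) \<and>
      dual_le C (\<lambda>x. - f x) (\<lambda>x. \<Sum>i=1..n. dual_action G \<rho> (g i) \<phi> x)"
      unfolding cobounded_type_def by blast
    have "\<exists>(n::nat) g. (\<forall>i\<in>{1..n}. g i \<in> carrier G) \<and>
      (\<forall>c\<in>C. \<bar>f c\<bar> \<le> (\<Sum>i=1..n. \<phi> (\<rho> (inv (g i)) c)))" if f: "f \<in> continuous_dual" for f
    proof -
      obtain n :: nat and g where g: "\<forall>i\<in>{1..n}. g i \<in> carrier G"
        "dual_le C f (\<lambda>x. \<Sum>i=1..n. dual_action G \<rho> (g i) \<phi> x)"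
        "dual_le C (\<lambda>x. - f x) (\<lambda>x. \<Sum>i=1..n. dual_action G \<rho> (g i) \<phi> x)"
        using bspec[OF * f] by blast
      have "\<bar>f c\<bar> \<le> (\<Sum>i=1..n. \<phi> (\<rho> (inv (g i)) c))" if "c \<in> C" for c
        using bspec[OF g(2)[unfolded dual_le_def dual_action_def] that]
          bspec[OF g(3)[unfolded dual_le_def dual_action_def] that] by linarith
      then show ?thesis using g(1) by blast
    qed
    then show ?thesis using that \<phi> by blast
  qed
  obtain n0 :: nat and g0 where g0: "\<And>i. i \<in> {1..n0} \<Longrightarrow> g0 i \<in> carrier G"
    and dom0: "\<And>c. c \<in> C \<Longrightarrow> \<bar>\<phi> c\<bar> \<le> (\<Sum>i=1..n0. \<phi> (\<rho> (inv (g0 i)) c))"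
    using dom[OF \<phi>] by blast
  define \<phi>1 where "\<phi>1 c = (\<Sum>i=1..n0. \<phi> (\<rho> (inv (g0 i)) c))" for c
  have \<phi>1: "\<phi>1 \<in> continuous_dual"
  proof -
    have "(\<lambda>c. \<phi> (\<rho> (inv (g0 i)) c)) \<in> continuous_dual" if "i \<in> {1..n0}" for i
      using translate_dual[OF \<phi>] g0[OF that] by simp
    then show ?thesis
      unfolding \<phi>1_def continuous_dual_def
      by (auto intro!: linear_compose_sum continuous_on_sum)
  qed
  have ge: "\<bar>\<phi> c\<bar> \<le> \<phi>1 c" if "c \<in> C" for c using dom0[OF that] by (simp add: \<phi>1_def)
  have nonneg: "0 \<le> \<phi>1 (\<rho> g c)" if "c \<in> C" "g \<in> carrier G" for c g
    using ge[OF rep_cone[OF that(2,1)]] by linarith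
  define \<psi> where "\<psi> = average \<phi>1"
  have unit_ge: "(1 / 2) ^ Suc k * \<phi>1 (\<rho> (enum k) c) \<le> \<psi> c" if "c \<in> C" for c k
    using average_gap[OF minus_dual[OF \<phi>1], of c 0 k] nonneg[OF that]
    by (simp add: average_minus[OF \<phi>1] \<psi>_def)
  have "0 \<le> \<psi> c" if "c \<in> C" for c
  proof -
    have "0 \<le> (1 / 2) ^ Suc 0 * \<phi>1 (\<rho> (enum 0) c)" using nonneg[OF that enum_carrier, of 0] by simp
    then show ?thesis using unit_ge[OF that, of 0] by linarith
  qed
  moreover have "\<exists>k\<ge>0. \<forall>c\<in>C. \<bar>f c\<bar> \<le> k * \<psi> c" if f: "f \<in> continuous_dual" for f
  proof -
    obtain n :: nat and g where g: "\<And>i. i \<in> {1..n} \<Longrightarrow> g i \<in> carrier G"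
      and le: "\<And>c. c \<in> C \<Longrightarrow> \<bar>f c\<bar> \<le> (\<Sum>i=1..n. \<phi> (\<rho> (inv (g i)) c))"
      using dom[OF f] by blast
    have "\<exists>k. enum k = inv (g i)" if "i \<in> {1..n}" for i
      using enum inv_closed[OF g[OF that]] by (metis imageE)
    then obtain \<kappa> where \<kappa>: "\<And>i. i \<in> {1..n} \<Longrightarrow> enum (\<kappa> i) = inv (g i)" by metis
    have "\<bar>f c\<bar> \<le> (\<Sum>i=1..n. 2 ^ Suc (\<kappa> i)) * \<psi> c" if c: "c \<in> C" for c
    proof -
      have "(\<Sum>i=1..n. \<phi> (\<rho> (inv (g i)) c)) \<le> (\<Sum>i=1..n. 2 ^ Suc (\<kappa> i) * \<psi> c)"
      proof (rule sum_mono)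
        fix i assume i: "i \<in> {1..n}"
        have "\<phi> (\<rho> (inv (g i)) c) \<le> \<phi>1 (\<rho> (inv (g i)) c)"
          using ge[OF rep_cone[OF inv_closed[OF g[OF i]] c]] by linarith
        also have "\<dots> = 2 ^ Suc (\<kappa> i) * ((1 / 2) ^ Suc (\<kappa> i) * \<phi>1 (\<rho> (enum (\<kappa> i)) c))"
          by (simp add: \<kappa>[OF i] power_one_over)
        also have "\<dots> \<le> 2 ^ Suc (\<kappa> i) * \<psi> c"
          by (intro mult_left_mono unit_ge[OF c]) simp
        finally show "\<phi> (\<rho> (inv (g i)) c) \<le> 2 ^ Suc (\<kappa> i) * \<psi> c" .
      qed
      then show ?thesis using le[OF c] by (simp only: sum_distrib_right)
    qed
    moreover have "0 \<le> (\<Sum>i=1..n. 2 ^ Suc (\<kappa> i) :: real)" by (intro sum_nonneg) simp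
    ultimately show ?thesis by blast
  qed
  ultimately show ?thesis
    using average_dual[OF \<phi>1] unfolding order_unit_def \<psi>_def by blast
qed

lemma order_unit_pos:
  assumes \<psi>: "order_unit \<psi>" and c: "c \<in> C" "c \<noteq> 0"
  shows "0 < \<psi> c"
proof -
  obtain f where f: "f \<in> continuous_dual" "f c \<noteq> 0" using continuous_dual_separates[OF c(2)] by blast
  then obtain k where "\<bar>f c\<bar> \<le> k * \<psi> c" using \<psi> c(1) unfolding order_unit_def by blast
  then have "\<psi> c \<noteq> 0" using f(2) by auto
  then show ?thesis using \<psi> c(1) unfolding order_unit_def by (simp add: less_le)
qed

text \<open>Otherwise there are \<open>g n\<close> and \<open>x n\<close> in the cone with \<open>\<psi> (x n) = 2\<^sup>-\<^sup>n\<close> and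
  \<open>\<psi> (\<rho> (g n) (x n)) > 2\<^sup>n\<close>. The sum \<open>y\<close> of the \<open>x n\<close> exists in the cone, and positivity gives
  \<open>\<psi> (\<rho> (g n) y) > 2\<^sup>n\<close>, although \<open>\<psi>\<close> is bounded on the orbit of \<open>y\<close>.\<close>

lemma order_unit_uniformly_dominated:
  assumes \<psi>: "order_unit \<psi>"
  shows "\<exists>K>0. \<forall>g\<in>carrier G. \<forall>c\<in>C. \<psi> (\<rho> g c) \<le> K * \<psi> c"
proof (rule ccontr)
  assume no: "\<not> ?thesis"
  have \<psi>E: "\<psi> \<in> continuous_dual" and \<psi>0: "\<And>c. c \<in> C \<Longrightarrow> 0 \<le> \<psi> c"
    using \<psi> by (auto simp: order_unit_def)
  have "\<exists>g c. g \<in> carrier G \<and> c \<in> C \<and> 4 ^ n * \<psi> c < \<psi> (\<rho> g c)" for n :: nat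
  proof (rule ccontr)
    assume "\<nexists>g c. g \<in> carrier G \<and> c \<in> C \<and> 4 ^ n * \<psi> c < \<psi> (\<rho> g c)"
    then have "\<forall>g\<in>carrier G. \<forall>c\<in>C. \<psi> (\<rho> g c) \<le> 4 ^ n * \<psi> c" by (simp add: not_less)
    moreover have "(0::real) < 4 ^ n" by simp
    ultimately show False using no by blast
  qed
  then obtain g c where g: "\<And>n. g n \<in> carrier G" and c: "\<And>n. c n \<in> C"
    and big: "\<And>n::nat. 4 ^ n * \<psi> (c n) < \<psi> (\<rho> (g n) (c n))" by metis
  have pos: "0 < \<psi> (c n)" for n
  proof (rule order_unit_pos[OF \<psi> c])
    show "c n \<noteq> 0"
      using big[of n] continuous_dual_arith(1)[OF \<psi>E] continuous_dual_arith(1)[OF translate_dual[OF \<psi>E g[of n]]]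
      by auto
  qed
  define x where "x n = (1 / (2 ^ n * \<psi> (c n))) *\<^sub>R c n" for n
  have xC: "x n \<in> C" for n
    unfolding x_def using pos[of n] by (intro convex_cone_scaleR[OF cone] c) simp
  have \<psi>x: "\<psi> (x n) = (1 / 2) ^ n" for n
    using pos[of n] by (simp add: x_def continuous_dual_arith(4)[OF \<psi>E] power_one_over)
  have "\<exists>y\<in>C. \<forall>f\<in>continuous_dual. (\<lambda>n. f (x n)) sums f y"
  proof (rule weakly_convergent_series[OF complete cone xC])
    fix f :: "'a \<Rightarrow> real" assume "f \<in> continuous_dual"
    then obtain k where k: "0 \<le> k" "\<forall>c\<in>C. \<bar>f c\<bar> \<le> k * \<psi> c" using \<psi> unfolding order_unit_def by blast
    show "summable (\<lambda>n. f (x n))"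
    proof (rule summable_comparison_test)
      show "summable (\<lambda>n. k * (1 / 2 :: real) ^ n)" by (intro summable_mult summable_geometric) simp
      show "\<exists>N. \<forall>n\<ge>N. norm (f (x n)) \<le> k * (1 / 2) ^ n"
        using bspec[OF k(2) xC] \<psi>x by auto
    qed
  qed
  then obtain y where y: "y \<in> C" "\<And>f. f \<in> continuous_dual \<Longrightarrow> (\<lambda>n. f (x n)) sums f y" by blast
  obtain b where b: "0 < b" "\<forall>g\<in>carrier G. \<bar>\<psi> (\<rho> g y)\<bar> \<le> b" using orbit_bounded[OF \<psi>E] by blast
  have "2 ^ n \<le> b" for n
  proof -
    have s: "(\<lambda>j. \<psi> (\<rho> (g n) (x j))) sums \<psi> (\<rho> (g n) y)"
      by (rule y(2)[OF translate_dual[OF \<psi>E g]])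
    have "\<psi> (\<rho> (g n) (x n)) \<le> \<psi> (\<rho> (g n) y)"
      using sum_le_suminf[OF sums_summable[OF s], of "{n}"] sums_unique[OF s] \<psi>0[OF rep_cone[OF g xC]]
      by simp
    moreover have "\<psi> (\<rho> (g n) (x n)) = \<psi> (\<rho> (g n) (c n)) / (2 ^ n * \<psi> (c n))"
      by (simp add: x_def continuous_dual_arith(4)[OF translate_dual[OF \<psi>E g]])
    moreover have "2 ^ n \<le> \<psi> (\<rho> (g n) (c n)) / (2 ^ n * \<psi> (c n))"
    proof -
      have "(2::real) ^ n * (2 ^ n * \<psi> (c n)) = 4 ^ n * \<psi> (c n)"
        by (simp add: power_mult_distrib[symmetric] mult.assoc[symmetric])
      then have "2 ^ n * (2 ^ n * \<psi> (c n)) \<le> \<psi> (\<rho> (g n) (c n))" using big[of n] by linarith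
      moreover have "0 < 2 ^ n * \<psi> (c n)" using pos[of n] by simp
      ultimately show ?thesis by (simp only: pos_le_divide_eq)
    qed
    ultimately show ?thesis using bspec[OF b(2) g[of n]] by linarith
  qed
  then show False using real_arch_pow[of 2 b] by (auto simp: not_less[symmetric])
qed

text \<open>The closed convex hull of the orbit, described by its support function, so that weak compactness
  and invariance need no separation argument.\<close>

definition orbit_hull :: "'a \<Rightarrow> 'a set" where
  "orbit_hull x = {y\<in>C. \<forall>f\<in>continuous_dual. f y \<le> (SUP g\<in>carrier G. f (\<rho> g x))}"

lemma compact_orbit_hull: "compact (evaluation ` orbit_hull x)"
  unfolding orbit_hull_def by (rule weakly_compact_section[OF complete])

lemma orbit_bdd_above:
  assumes f: "f \<in> continuous_dual" shows "bdd_above ((\<lambda>g. f (\<rho> g x)) ` carrier G)"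
proof -
  obtain b where "\<forall>g\<in>carrier G. \<bar>f (\<rho> g x)\<bar> \<le> b" using orbit_bounded[OF f] by blast
  then show ?thesis by (intro bdd_aboveI2[of _ _ b]) (simp add: abs_le_iff)
qed

lemma orbit_hull_le:
  assumes "y \<in> orbit_hull x" and f: "f \<in> continuous_dual"
    and "\<And>g. g \<in> carrier G \<Longrightarrow> f (\<rho> g x) \<le> u"
  shows "f y \<le> u"
proof -
  have "f y \<le> (SUP g\<in>carrier G. f (\<rho> g x))" using assms by (simp add: orbit_hull_def)
  also have "\<dots> \<le> u" using assms(3) by (intro cSUP_least) (auto simp: carrier_not_empty)
  finally show ?thesis .
qed

lemma orbit_hull_abs_le:
  assumes y: "y \<in> orbit_hull x" and f: "f \<in> continuous_dual"
    and u: "\<And>g. g \<in> carrier G \<Longrightarrow> \<bar>f (\<rho> g x)\<bar> \<le> u"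
  shows "\<bar>f y\<bar> \<le> u"
proof -
  have "f y \<le> u" using u by (intro orbit_hull_le[OF y f]) (simp add: abs_le_iff)
  moreover have "- f y \<le> u" using u by (intro orbit_hull_le[OF y minus_dual[OF f]]) (simp add: abs_le_iff)
  ultimately show ?thesis by simp
qed

lemma orbit_in_hull:
  assumes "x \<in> C" "g \<in> carrier G" shows "\<rho> g x \<in> orbit_hull x"
  using assms by (auto simp: orbit_hull_def rep_cone intro!: cSUP_upper orbit_bdd_above)

lemma convex_orbit_hull: "convex (orbit_hull x)"
proof (rule convexI)
  fix y z and s t :: real
  assume y: "y \<in> orbit_hull x" and z: "z \<in> orbit_hull x" and st: "0 \<le> s" "0 \<le> t" "s + t = 1"
  have "s *\<^sub>R y + t *\<^sub>R z \<in> C"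
    using y z st by (intro convex_cone_add[OF cone] convex_cone_scaleR[OF cone]) (auto simp: orbit_hull_def)
  moreover have "f (s *\<^sub>R y + t *\<^sub>R z) \<le> (SUP g\<in>carrier G. f (\<rho> g x))" (is "_ \<le> ?u")
    if f: "f \<in> continuous_dual" for f
  proof -
    have "s * f y + t * f z \<le> s * ?u + t * ?u"
      using y z st f by (intro add_mono mult_left_mono) (auto simp: orbit_hull_def)
    also have "\<dots> = ?u" using st by (simp only: distrib_right[symmetric])
    finally show ?thesis by (simp add: continuous_dual_arith[OF f])
  qed
  ultimately show "s *\<^sub>R y + t *\<^sub>R z \<in> orbit_hull x" by (simp add: orbit_hull_def)
qed

lemma average_in_orbit_hull:
  assumes c: "c \<in> orbit_hull b"
  shows "\<exists>y\<in>orbit_hull b. \<forall>f\<in>continuous_dual. f y = average f c"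
proof -
  obtain y where y: "y \<in> C" "\<And>f. f \<in> continuous_dual \<Longrightarrow> f y = average f c"
    using average_point[of c] c by (auto simp: orbit_hull_def)
  have "f y \<le> (SUP g\<in>carrier G. f (\<rho> g b))" if f: "f \<in> continuous_dual" for f
    unfolding y(2)[OF f]
  proof (rule orbit_hull_le[OF c average_dual[OF f]], rule average_le[OF f])
    fix g h assume "g \<in> carrier G" "h \<in> carrier G"
    then have "f (\<rho> h (\<rho> g b)) = f (\<rho> (h \<otimes> g) b)" "h \<otimes> g \<in> carrier G" by (simp_all add: rep_mult)
    then show "f (\<rho> h (\<rho> g b)) \<le> (SUP g\<in>carrier G. f (\<rho> g b))"
      using cSUP_upper[OF _ orbit_bdd_above[OF f]] by simp
  qed
  then have "y \<in> orbit_hull b" using y(1) by (simp add: orbit_hull_def)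
  then show ?thesis using y(2) by blast
qed

text \<open>The argument of Markov and Kakutani: Cesaro means of the iterates of the averaging operator are
  asymptotically invariant, and a weak cluster point is invariant.\<close>

lemma stationary_point:
  assumes b: "b \<in> C"
  shows "\<exists>x\<in>orbit_hull b. \<forall>f\<in>continuous_dual. f x = average f x"
proof -
  have "\<forall>c\<in>orbit_hull b. \<exists>y. y \<in> orbit_hull b \<and> (\<forall>f\<in>continuous_dual. f y = average f c)"
    using average_in_orbit_hull by blast
  from bchoice[OF this] obtain T where T: "\<And>c. c \<in> orbit_hull b \<Longrightarrow> T c \<in> orbit_hull b"
    "\<And>c f. c \<in> orbit_hull b \<Longrightarrow> f \<in> continuous_dual \<Longrightarrow> f (T c) = average f c"
    by blast
  define z where "z n = (T ^^ n) b" for n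
  have z: "z n \<in> orbit_hull b" for n
    using T(1) orbit_in_hull[OF b one_closed] by (induction n) (simp_all add: z_def rep_one)
  have z_Suc: "f (z (Suc n)) = average f (z n)" if "f \<in> continuous_dual" for f n
    using T(2)[OF z that, of n] by (simp add: z_def)
  \<comment> \<open>\<open>A N\<close> is the mean of \<open>z 0, \<dots>, z N\<close>.\<close>
  define A where "A N = (\<Sum>n<Suc N. (1 / real (Suc N)) *\<^sub>R z n)" for N
  have A: "A N \<in> orbit_hull b" for N
    unfolding A_def using convex_orbit_hull z by (intro convex_sum) simp_all
  have fA: "f (A N) = (1 / real (Suc N)) * (\<Sum>n<Suc N. f (z n))" if "f \<in> continuous_dual" for f N
    unfolding A_def using continuous_dual_linear[OF that]
    by (simp only: linear_sum linear_scale real_scaleR_def sum_distrib_left)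
  have lim: "(\<lambda>N. average f (A N) - f (A N)) \<longlonglongrightarrow> 0" if f: "f \<in> continuous_dual" for f
  proof -
    obtain u where u: "0 < u" "\<forall>g\<in>carrier G. \<bar>f (\<rho> g b)\<bar> \<le> u" using orbit_bounded[OF f] by blast
    have fz: "\<bar>f (z n)\<bar> \<le> u" for n using u by (intro orbit_hull_abs_le[OF z f]) simp
    have eq: "average f (A N) - f (A N) = (f (z (Suc N)) - f (z 0)) * (1 / real (Suc N))" for N
    proof -
      have "average f (A N) - f (A N) = (1 / real (Suc N)) * (\<Sum>n<Suc N. average f (z n) - f (z n))"
        by (simp only: fA[OF f] fA[OF average_dual[OF f]] sum_subtractf right_diff_distrib)
      also have "(\<Sum>n<Suc N. average f (z n) - f (z n)) = f (z (Suc N)) - f (z 0)"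
        using sum_lessThan_telescope[of "\<lambda>n. f (z n)" "Suc N"] by (simp only: z_Suc[OF f, symmetric])
      finally show ?thesis by (simp only: mult.commute)
    qed
    show ?thesis
    proof (rule Lim_null_comparison)
      show "(\<lambda>N. 2 * u * inverse (real (Suc N))) \<longlonglongrightarrow> 0"
        by (intro tendsto_mult_right_zero LIMSEQ_inverse_real_of_nat)
      show "eventually (\<lambda>N. norm (average f (A N) - f (A N)) \<le> 2 * u * inverse (real (Suc N))) sequentially"
      proof (intro always_eventually allI)
        fix N
        have "\<bar>f (z (Suc N)) - f (z 0)\<bar> \<le> 2 * u" using fz[of "Suc N"] fz[of 0] by linarith
        then have "\<bar>f (z (Suc N)) - f (z 0)\<bar> * inverse (real (Suc N)) \<le> 2 * u * inverse (real (Suc N))"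
          by (rule mult_right_mono) simp
        then show "norm (average f (A N) - f (A N)) \<le> 2 * u * inverse (real (Suc N))"
          unfolding eq real_norm_def abs_mult inverse_eq_divide by simp
      qed
    qed
  qed
  define F where "F = filtermap (\<lambda>N. evaluation (A N)) sequentially"
  have "F \<noteq> bot" by (simp add: F_def filtermap_bot_iff)
  moreover have "eventually (\<lambda>y. y \<in> evaluation ` orbit_hull b) F"
    using A by (simp add: F_def eventually_filtermap)
  ultimately obtain x where x: "x \<in> orbit_hull b" "inf (nhds (evaluation x)) F \<noteq> bot"
    using compact_orbit_hull[of b] unfolding compact_filter by (metis imageE)
  have "f x = average f x" if f: "f \<in> continuous_dual" for f
  proof -
    let ?\<delta> = "\<lambda>y :: ('a \<Rightarrow> real) \<Rightarrow> real. y (average f) - y f"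
    have ev: "evaluation c (average f) - evaluation c f = average f c - f c" for c
      using f average_dual[OF f] by (simp add: evaluation_def)
    have "continuous_on UNIV ?\<delta>"
      by (intro continuous_on_diff continuous_coordinate)
    then have "(?\<delta> \<longlongrightarrow> ?\<delta> (evaluation x)) (nhds (evaluation x))"
      using tendsto_at_iff_tendsto_nhds[of ?\<delta> "evaluation x"] by (simp add: continuous_on_def)
    then have "(?\<delta> \<longlongrightarrow> average f x - f x) (inf (nhds (evaluation x)) F)"
      unfolding ev by (rule tendsto_mono[OF inf_le1])
    moreover have "(?\<delta> \<longlongrightarrow> 0) F"
      unfolding F_def filterlim_filtermap ev by (rule lim[OF f])
    then have "(?\<delta> \<longlongrightarrow> 0) (inf (nhds (evaluation x)) F)"
      by (rule tendsto_mono[OF inf_le2])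
    ultimately have "average f x - f x = 0" by (rule tendsto_unique[OF x(2)])
    then show ?thesis by simp
  qed
  then show ?thesis using x(1) by blast
qed

text \<open>The slice supplied by \<open>small_slices\<close> contains \<open>\<rho> s x\<close> and \<open>\<rho> s (\<rho> g0 x)\<close> for a suitable \<open>s\<close>. As
  the family \<open>H\<close> is invariant, moving back by \<open>inv s\<close> shows that \<open>h0\<close> differs by at most \<open>\<delta> / 2\<close>
  between \<open>x\<close> and \<open>\<rho> g0 x\<close>, where it differs by \<open>\<delta>\<close>.\<close>

theorem stationary_imp_fixed:
  assumes x: "x \<in> C" and stat: "\<And>f. f \<in> continuous_dual \<Longrightarrow> f x = average f x"
    and g0: "g0 \<in> carrier G"
  shows "\<rho> g0 x = x"
proof (rule ccontr)
  assume "\<rho> g0 x \<noteq> x"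
  then obtain h0 where h0: "h0 \<in> continuous_dual" "h0 (\<rho> g0 x - x) \<noteq> 0"
    using continuous_dual_separates[of "\<rho> g0 x - x"] by auto
  define \<delta> where "\<delta> = \<bar>h0 (\<rho> g0 x - x)\<bar>"
  have \<delta>: "0 < \<delta>" using h0(2) by (simp add: \<delta>_def)
  define H where "H = orbit_functionals h0"
  have H: "H \<subseteq> continuous_dual" "equicontinuous H"
    unfolding H_def using h0(1) by (simp_all add: orbit_functionals_dual equicontinuous_orbit_functionals)
  define S where "S = orbit_hull x"
  define D where "D = rational_span (\<lambda>n. \<rho> (enum n) x)"
  have appr: "\<exists>d\<in>D. \<forall>h\<in>H. \<bar>h (y - d)\<bar> \<le> \<delta> / 8" if y: "y \<in> S" for y
    unfolding D_def
  proof (rule approximation_by_rational_span[OF H])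
    show "0 < \<delta> / 8" using \<delta> by simp
    fix f :: "'a \<Rightarrow> real" assume f: "f \<in> continuous_dual" and 0: "\<And>n. f (\<rho> (enum n) x) = 0"
    have "f (\<rho> g x) = 0" if "g \<in> carrier G" for g
      using that 0 enum by (metis imageE)
    then have "\<bar>f y\<bar> \<le> 0" by (intro orbit_hull_abs_le[OF y[unfolded S_def] f]) simp
    then show "f y = 0" by simp
  qed
  obtain b where b: "0 < b" "\<forall>g\<in>carrier G. \<bar>h0 (\<rho> g x)\<bar> \<le> b" using orbit_bounded[OF h0(1)] by blast
  have bdd: "\<bar>h y\<bar> \<le> b" if y: "y \<in> S" and h: "h \<in> H" for y h
  proof -
    obtain g where g: "g \<in> carrier G" "h = (\<lambda>x. h0 (\<rho> g x))"
      using h by (auto simp: H_def orbit_functionals_def)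
    show ?thesis
    proof (rule orbit_hull_abs_le[OF y[unfolded S_def] subsetD[OF H(1) h]])
      show "\<bar>h (\<rho> g' x)\<bar> \<le> b" if "g' \<in> carrier G" for g'
        using bspec[OF b(2) m_closed[OF g(1) that]] by (simp add: g rep_mult that)
    qed
  qed
  then have bdd': "\<forall>y\<in>S. \<forall>h\<in>H. \<bar>h y\<bar> \<le> b" by blast
  have appr': "\<forall>y\<in>S. \<exists>d\<in>D. \<forall>h\<in>H. \<bar>h (y - d)\<bar> \<le> \<delta> / 8" using appr by blast
  have "x \<in> S" using orbit_in_hull[OF x one_closed] by (simp add: S_def rep_one)
  then have ne: "S \<noteq> {}" by blast
  have count: "countable D" unfolding D_def by (rule countable_rational_span)
  have compact: "compact (evaluation ` S)" unfolding S_def by (rule compact_orbit_hull)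
  have "0 \<le> \<delta> / 8" using \<delta> by simp
  from small_slices[where S = S and H = H and D = D and e = "\<delta> / 8" and R = b, OF compact ne H(1) count appr' this bdd']
  obtain f d c m where f: "f \<in> continuous_dual" and c: "0 \<le> c"
    and least: "\<forall>u. (\<forall>y\<in>S. f y \<le> u) \<longrightarrow> m \<le> u"
    and slice: "\<forall>y\<in>S. f y \<le> m \<and> (\<forall>h\<in>H. \<bar>h (y - d)\<bar> \<le> \<delta> / 8 + c * (m - f y))"
    by (elim bexE exE conjE)
  have le_m: "f y \<le> m" if "y \<in> S" for y using slice that by blast
  have small: "\<bar>h (y - d)\<bar> \<le> \<delta> / 8 + c * (m - f y)" if "y \<in> S" "h \<in> H" for y h
    using slice that by blast
  obtain k where k: "enum k = g0" using g0 enum by (metis imageE)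
  \<comment> \<open>Depth of the slice: points with \<open>m - f y \<le> \<eta>\<close> lie within \<open>\<delta> / 8 + c * \<eta> \<le> \<delta> / 4\<close> of \<open>d\<close>.\<close>
  define \<eta> where "\<eta> = \<delta> / (8 * (c + 1))"
  have \<eta>: "0 < \<eta>" using \<delta> c by (simp add: \<eta>_def)
  have c\<eta>: "c * \<eta> \<le> \<delta> / 8" using \<delta> c by (simp add: \<eta>_def field_simps)
  define w :: real where "w = (1 / 2) ^ Suc k"
  have w: "0 < w" "w \<le> 1" unfolding w_def by (simp, intro power_le_one) simp_all
  \<comment> \<open>The factor \<open>w\<close> is the weight of \<open>g0\<close>: this much closer to the top, \<open>\<rho> s x\<close> forces
    \<open>\<rho> s (\<rho> g0 x)\<close> to depth \<open>\<eta>\<close>.\<close>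
  have "\<exists>s\<in>carrier G. m - w * \<eta> < f (\<rho> s x)"
  proof (rule ccontr)
    assume no: "\<not> ?thesis"
    have le: "f (\<rho> g x) \<le> m - w * \<eta>" if "g \<in> carrier G" for g
      using no that by (meson not_le)
    have "f y \<le> m - w * \<eta>" if "y \<in> S" for y
      using that[unfolded S_def] f le by (rule orbit_hull_le)
    then have "m \<le> m - w * \<eta>" using least by blast
    moreover have "0 < w * \<eta>" using w(1) \<eta> by (rule mult_pos_pos)
    ultimately show False by simp
  qed
  then obtain s where s: "s \<in> carrier G" "m - w * \<eta> < f (\<rho> s x)" by blast
  have in_S: "\<rho> s x \<in> S" "\<rho> s (\<rho> g0 x) \<in> S"
    using orbit_in_hull[OF x s(1)] orbit_in_hull[OF x m_closed[OF s(1) g0]]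
    by (simp_all add: S_def rep_mult s(1) g0)
  have "w * (m - f (\<rho> s (\<rho> g0 x))) \<le> m - average (\<lambda>x. f (\<rho> s x)) x"
    unfolding w_def k[symmetric]
  proof (rule average_gap[OF translate_dual[OF f s(1)]])
    fix g assume g: "g \<in> carrier G"
    show "f (\<rho> s (\<rho> g x)) \<le> m"
      using le_m[of "\<rho> (s \<otimes> g) x"] orbit_in_hull[OF x m_closed[OF s(1) g]]
      by (simp add: S_def rep_mult s(1) g)
  qed
  also have "average (\<lambda>x. f (\<rho> s x)) x = f (\<rho> s x)"
    using stat[OF translate_dual[OF f s(1)]] by simp
  also have "m - f (\<rho> s x) \<le> w * \<eta>" using s(2) by simp
  finally have near2: "m - f (\<rho> s (\<rho> g0 x)) \<le> \<eta>" using w(1) by simp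
  have "w * \<eta> \<le> 1 * \<eta>" using w(2) \<eta> by (intro mult_right_mono) auto
  then have near1: "m - f (\<rho> s x) \<le> \<eta>" using s(2) by simp
  define h where "h = (\<lambda>x. h0 (\<rho> (inv s) x))"
  have h: "h \<in> H" unfolding H_def orbit_functionals_def h_def using s(1) by blast
  note arith = continuous_dual_arith[OF subsetD[OF H(1) h]]
  have close: "\<bar>h y - h d\<bar> \<le> \<delta> / 4" if "y \<in> S" "m - f y \<le> \<eta>" for y
  proof -
    have "c * (m - f y) \<le> c * \<eta>" using that(2) c by (rule mult_left_mono)
    then show ?thesis using small[OF that(1) h] c\<eta> by (simp add: arith)
  qed
  have "h (\<rho> s x) = h0 x" "h (\<rho> s (\<rho> g0 x)) = h0 (\<rho> g0 x)"
    by (simp_all add: h_def rep_inv s(1))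
  then have "\<delta> \<le> \<delta> / 2"
    using close[OF in_S(1) near1] close[OF in_S(2) near2]
    unfolding \<delta>_def continuous_dual_arith(3)[OF h0(1)] by linarith
  then show False using \<delta> by simp
qed

text \<open>On the orbit of \<open>b \<noteq> 0\<close> the order unit is at least \<open>\<psi> b / K\<close>, since \<open>inv g\<close> maps \<open>\<rho> g b\<close> back to \<open>b\<close>.
  This lower bound holds on the hull of the orbit, so the stationary point found there is not \<open>0\<close>.\<close>

theorem exists_nonzero_fixed_point:
  assumes "cobounded_type G \<rho> C" and "C \<noteq> {0}"
  shows "\<exists>x\<in>C. x \<noteq> 0 \<and> (\<forall>g\<in>carrier G. \<rho> g x = x)"
proof -
  obtain b where b: "b \<in> C" "b \<noteq> 0" using assms(2) convex_cone_contains_0[OF cone] by blast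
  obtain \<psi> where \<psi>: "order_unit \<psi>" using cobounded_imp_order_unit[OF assms(1)] by blast
  then have \<psi>E: "\<psi> \<in> continuous_dual" by (simp add: order_unit_def)
  obtain K where K: "0 < K" "\<forall>g\<in>carrier G. \<forall>c\<in>C. \<psi> (\<rho> g c) \<le> K * \<psi> c"
    using order_unit_uniformly_dominated[OF \<psi>] by blast
  obtain x where x: "x \<in> orbit_hull b" "\<And>f. f \<in> continuous_dual \<Longrightarrow> f x = average f x"
    using stationary_point[OF b(1)] by blast
  have "- \<psi> x \<le> - (\<psi> b / K)"
  proof (rule orbit_hull_le[OF x(1) minus_dual[OF \<psi>E]])
    fix g assume g: "g \<in> carrier G"
    have "\<psi> (\<rho> (inv g) (\<rho> g b)) \<le> K * \<psi> (\<rho> g b)"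
      using K(2) inv_closed[OF g] rep_cone[OF g b(1)] by blast
    then show "- \<psi> (\<rho> g b) \<le> - (\<psi> b / K)"
      using K(1) by (simp add: rep_inv[OF g] pos_divide_le_eq mult.commute)
  qed
  moreover have "0 < \<psi> b / K" using order_unit_pos[OF \<psi> b] K(1) by simp
  ultimately have "x \<noteq> 0" using continuous_dual_arith(1)[OF \<psi>E] by auto
  moreover have xC: "x \<in> C" using x(1) by (simp add: orbit_hull_def)
  moreover have "\<rho> g x = x" if "g \<in> carrier G" for g
    using stationary_imp_fixed[OF xC x(2) that] .
  ultimately show ?thesis by blast
qed

end

theorem theorem9:
  fixes G :: "('g, 'm) monoid_scheme"
    and \<rho> :: "'g \<Rightarrow> 'a \<Rightarrow> 'a::{locally_convex_space, t2_space}"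
    and C :: "'a set"
  assumes "group G" and "countable (carrier G)"
    and "proper_cone C" and "weakly_complete C" and "C \<noteq> {0}"
    and "cone_representation G \<rho> C"
    and "cobounded_type G \<rho> C"
    and "equicontinuous_rep G \<rho>"
  shows "\<exists>x\<in>C. x \<noteq> 0 \<and> (\<forall>g\<in>carrier G. \<rho> g x = x)"
proof -
  have "carrier G \<noteq> {}" using assms(1) group.is_monoid monoid.one_closed by fastforce
  then have "range (from_nat_into (carrier G)) = carrier G"
    using assms(2) by (rule range_from_nat_into)
  then interpret equicontinuous_cone_rep G \<rho> C "from_nat_into (carrier G)"
    using assms by (intro equicontinuous_cone_rep.intro) (simp_all add: proper_cone_def)
  show ?thesis using assms(7,5) by (rule exists_nonzero_fixed_point)
qed

end
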